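(* Let $g \geqslant 3$ be an integer and let $$\gamma_g = g \min_{m=1,2,\ldots} \left(\frac{2g}{m\,\varphi(g)\log g}\right)^{1/m}.$$ Then there is an absolute constant $C>0$ such that for all sufficiently large $N$ we have $P_g(N) \leqslant C\,\gamma_g^N$.
   Context: Here $\varphi$ is Euler's totient function. For a finite tuple of $g$-ary digits $(d_0,\ldots,d_{N-1}) \in \{0,\ldots,g-1\}^N$ with $d_{N-1} \neq 0$ (equivalently, an infinite digit sequence $\mathcal{D}=\{d_i\}_{i\ge 0}$ whose last non-zero element is $d_{N-1}$; such $\mathcal{D}$ is said to have length $N$), define $u_{\mathcal{D},g}(n) = \sum_{i=0}^{n-1} d_i g^i$ and let $\varpi_{\mathcal{D},g}(N)$ be the number of $n$ with $1 \leqslant n \leqslant N$ for which $u_{\mathcal{D},g}(n)$ is prime. Let $\eta = 1$ if $g=2$ and $\eta = 0$ if $g \geqslant 3$. Then $P_g(N)$ denotes the number of sequences $\mathcal{D}$ of length $N$ such that $\varpi_{\mathcal{D},g}(N) = N - \eta$. *)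

theory Defs
  imports Complex_Main "HOL-Number_Theory.Totient" "HOL-Real_Asymp.Real_Asymp"
begin

definition digit_seqs :: "nat \<Rightarrow> nat \<Rightarrow> (nat \<Rightarrow> nat) set" where
  "digit_seqs g N = {d. (\<forall>i. d i < g) \<and> N \<ge> 1 \<and> d (N - 1) \<noteq> 0 \<and> (\<forall>i\<ge>N. d i = 0)}"

definition trunc :: "(nat \<Rightarrow> nat) \<Rightarrow> nat \<Rightarrow> nat \<Rightarrow> nat" where
  "trunc d g n = (\<Sum>i<n. d i * g ^ i)"

definition prime_trunc_count :: "(nat \<Rightarrow> nat) \<Rightarrow> nat \<Rightarrow> nat \<Rightarrow> nat" where
  "prime_trunc_count d g N = card {n \<in> {1..N}. prime (trunc d g n)}"

definition eta :: "nat \<Rightarrow> nat" where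
  "eta g = (if g = 2 then 1 else 0)"

definition P_count :: "nat \<Rightarrow> nat \<Rightarrow> nat" where
  "P_count g N = card {d \<in> digit_seqs g N. prime_trunc_count d g N = N - eta g}"

lemma finite_digit_seqs: "finite (digit_seqs g N)"
proof (rule finite_subset)
  show "digit_seqs g N \<subseteq>
      {d. \<forall>i. (i \<in> {..<N} \<longrightarrow> d i \<in> {..<g}) \<and> (i \<notin> {..<N} \<longrightarrow> d i = 0)}"
    by (auto simp: digit_seqs_def)
  show "finite {d. \<forall>i. (i \<in> {..<N} \<longrightarrow> d i \<in> {..<g}) \<and> (i \<notin> {..<N} \<longrightarrow> d i = 0)}"
    by (rule finite_set_of_finite_funs) auto
qed

definition gamma_term :: "nat \<Rightarrow> nat \<Rightarrow> real" where
  "gamma_term g m = (2 * real g / (real m * real (totient g) * ln (real g))) powr (1 / real m)"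

text \<open>The infimum below is a minimum: see \<open>gamma_min_attained\<close>.\<close>

definition gamma_const :: "nat \<Rightarrow> real" where
  "gamma_const g = real g * (INF m\<in>{1..}. gamma_term g m)"

lemma gamma_min_attained:
  assumes "g \<ge> 3"
  shows "\<exists>m\<ge>1. (\<forall>k\<ge>1. gamma_term g m \<le> gamma_term g k) \<and> gamma_const g = real g * gamma_term g m"
proof -
  define c where "c = 2 * real g / (real (totient g) * ln (real g))"
  have c: "c > 0" using assms by (simp add: c_def)
  have eq: "gamma_term g m = (c / real m) powr (1 / real m)" for m
    by (simp add: gamma_term_def c_def field_simps)
  have "((\<lambda>m::nat. (c / real m) powr (1 / real m)) \<longlongrightarrow> 1) at_top"
    using c by real_asymp
  then have lim: "gamma_term g \<longlonglongrightarrow> 1" by (simp add: eq[abs_def])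
  obtain m0 :: nat where m0: "c < real m0" using reals_Archimedean2 by blast
  then have m01: "m0 \<ge> 1" using c by (cases m0) auto
  have "gamma_term g m0 < 1"
    unfolding eq using m0 m01 c powr_less_mono2[of "1 / real m0" "c / real m0" 1] by simp
  from order_tendstoD(1)[OF lim this] obtain K where
    K: "\<And>k. k \<ge> K \<Longrightarrow> gamma_term g m0 < gamma_term g k"
    by (auto simp: eventually_at_top_linorder)
  define S where "S = {1..max K m0}"
  have S: "finite S" "m0 \<in> S" using m01 by (auto simp: S_def)
  obtain m where m: "m \<in> S" "\<And>k. k \<in> S \<Longrightarrow> gamma_term g m \<le> gamma_term g k"
    using S arg_min_if_finite(1)[of S "gamma_term g"] arg_min_least[of S _ "gamma_term g"] by blast
  have min: "gamma_term g m \<le> gamma_term g k" if "k \<ge> 1" for k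
  proof (cases "k \<in> S")
    case False
    then have "k \<ge> K" using that by (auto simp: S_def)
    then show ?thesis using K[of k] m(2)[OF S(2)] by linarith
  qed (use m in auto)
  have m1: "m \<ge> 1" using m(1) by (auto simp: S_def)
  have "(INF m\<in>{1..}. gamma_term g m) = gamma_term g m"
    by (rule cInf_eq_minimum) (use m1 min in auto)
  then show ?thesis using m1 min by (auto simp: gamma_const_def)
qed

end

theory Submission
  imports Defs "HOL-Library.FuncSet"
begin

text \<open>
  Let \<open>m\<close> attain the minimum in \<open>\<gamma>\<^sub>g\<close> and put \<open>Y = g\<^sup>m\<close>. A chain of prime truncations with end \<open>u\<close> of
  length \<open>N\<close> is prolonged by \<open>m\<close> digits by choosing \<open>j < Y\<close> such that \<open>u + j g\<^sup>N\<close> is prime, and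
  the Brun--Titchmarsh inequality allows fewer than \<open>\<gamma>\<^sub>g\<^sup>m = (g / \<phi>(g)) \<cdot> 2 Y / log Y\<close> such \<open>j\<close>
  once \<open>u > Y\<close>. The bound is a strict inequality between an integer and a number depending only
  on \<open>g\<close>, so the growth rate of the number of chains is strictly smaller than \<open>\<gamma>\<^sub>g\<close>. This absorbs the
  boundedly many \<open>u \<le> Y\<close> and the dependence of all constants on \<open>g\<close>; one may take \<open>C = 1\<close>.

  For a prime \<open>p\<close> not dividing \<open>g\<close> the admissible \<open>j\<close> avoid a residue class modulo \<open>p\<close>. For \<open>p\<close>
  dividing \<open>g\<close> one deletes the least populated class. Altogether a proportion of at least \<open>\<phi>(g) / g\<close>
  of the \<open>j\<close> survives, and it remains to show that a subset of an interval of length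
  \<open>Y\<close> avoiding one class modulo every prime \<open>p \<le> Y\<close> has fewer than \<open>2 Y / log Y\<close> elements.
  The constant \<open>2\<close> has to be exact, since a loss would be multiplied \<open>N / m\<close> times. Splitting into
  the two surviving classes modulo \<open>6\<close> before applying Selberg's sieve of level \<open>z = \<surd>Y / 3\<close> makes the
  gain from the secondary term of \<open>\<Sum> 1 / d\<close> (over \<open>d \<le> z\<close> coprime to \<open>6\<close>) exceed the error term. For
  \<open>Y \<le> 13000\<close> sieving by at most the primes \<open>2, 3, 5, 7, 11, 13, 17\<close> suffices.
\<close>

section \<open>Selberg's sieve\<close>

lemma card_residue_class_bounds:
  fixes X q r :: nat
  assumes "q > 0"
  shows "\<bar>real (card {t. t < X \<and> [t = r] (mod q)}) - real X / real q\<bar> \<le> 1"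
proof -
  define s where "s = r mod q"
  have s: "s < q" using assms by (simp add: s_def)
  \<comment> \<open>This is the ceiling of \<open>(X - s) / q\<close>, in a form that gives 0 when
    \<open>X \<le> s\<close>; as \<open>s \<le> q - 1\<close>, the subtraction never
    truncates.\<close>
  define K where "K = (X + (q - 1 - s)) div q"
  have eq: "{t. t < X \<and> [t = r] (mod q)} = (\<lambda>k. s + k * q) ` {..<K}"
  proof (intro equalityI subsetI)
    fix t assume "t \<in> {t. t < X \<and> [t = r] (mod q)}"
    then have t: "t < X" "t mod q = s" by (auto simp: Cong.cong_def s_def)
    have tt: "t = s + (t div q) * q" using t(2) by (metis mod_div_decomp add.commute)
    have "Suc (t div q) * q \<le> X + (q - 1 - s)" using tt t(1) s by simp
    then have "t div q < K" unfolding K_def using assms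
      by (metis Suc_le_eq div_le_mono nonzero_mult_div_cancel_right not_gr_zero)
    then show "t \<in> (\<lambda>k. s + k * q) ` {..<K}" using tt by blast
  next
    fix t assume "t \<in> (\<lambda>k. s + k * q) ` {..<K}"
    then obtain k where k: "k < K" "t = s + k * q" by auto
    have "Suc k * q \<le> K * q" using k by (intro mult_right_mono) auto
    also have "\<dots> \<le> X + (q - 1 - s)" unfolding K_def by simp
    finally have "t < X" using k s by simp
    moreover have "t mod q = s" using k s by simp
    ultimately show "t \<in> {t. t < X \<and> [t = r] (mod q)}" by (simp add: Cong.cong_def s_def)
  qed
  have "inj_on (\<lambda>k. s + k * q) {..<K}" using assms by (auto simp: inj_on_def)
  then have card: "card {t. t < X \<and> [t = r] (mod q)} = K" unfolding eq by (simp add: card_image)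
  have "K * q \<le> X + (q - 1 - s)" unfolding K_def by simp
  moreover have "X + (q - 1 - s) < K * q + q" unfolding K_def using assms
    by (metis add.commute dividend_less_div_times)
  ultimately have "K * q \<le> X + q" "X \<le> K * q + q" using s by simp_all
  then have "real K * real q \<le> real X + real q" "real X \<le> real K * real q + real q"
    by (metis of_nat_add of_nat_le_iff of_nat_mult)+
  then show ?thesis unfolding card using assms by (auto simp: abs_le_iff field_simps)
qed

text \<open>By the Chinese remainder theorem the conditions merge into a single class modulo
  \<open>\<Prod>F\<close>, so the error stays 1 however many primes are involved.\<close>

lemma card_simultaneous_residues_bounds:
  fixes F :: "nat set" and a :: "nat \<Rightarrow> nat"
  assumes "finite F" "\<And>p. p \<in> F \<Longrightarrow> prime p"
  shows "\<bar>real (card {t. t < X \<and> (\<forall>p\<in>F. [t = a p] (mod p))}) - real X / real (\<Prod>F)\<bar> \<le> 1"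
proof -
  have cop: "coprime p q" if "p \<in> F" "q \<in> F" "p \<noteq> q" for p q
    using that assms(2) primes_coprime by blast
  obtain x where x: "\<forall>p\<in>F. [x = a p] (mod p)"
    using chinese_remainder_nat[of F "\<lambda>p. p" a] assms(1) cop by blast
  have "(\<forall>p\<in>F. [t = a p] (mod p)) \<longleftrightarrow> [t = x] (mod \<Prod>F)" for t
  proof
    assume "\<forall>p\<in>F. [t = a p] (mod p)"
    then show "[t = x] (mod \<Prod>F)"
      using x by (intro coprime_cong_prod_nat cop) (auto simp: Cong.cong_def)
  next
    assume "[t = x] (mod \<Prod>F)"
    then show "\<forall>p\<in>F. [t = a p] (mod p)"
      using x assms(1) cong_dvd_modulus_nat[of t x "\<Prod>F"] by (auto intro: cong_trans dvd_prodI)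
  qed
  moreover have "\<Prod>F > 0" using assms(2) prime_gt_0_nat by (intro prod_pos) auto
  ultimately show ?thesis using card_residue_class_bounds by (simp del: of_nat_prod)
qed

text \<open>Moebius inversion on the lattice of subsets: with \<open>F = E \<union> H\<close> the
  signs factor into a product of \<open>1 - 1\<close> over \<open>G - E\<close>.\<close>

lemma sum_alternating_between:
  assumes "finite G" "E \<subseteq> G"
  shows "(\<Sum>F | E \<subseteq> F \<and> F \<subseteq> G. (-1::real) ^ card F) = (if E = G then (-1) ^ card E else 0)"
proof -
  have fin: "finite E" using assms finite_subset by blast
  have "(\<Sum>F | E \<subseteq> F \<and> F \<subseteq> G. (-1::real) ^ card F) = (\<Sum>H\<in>Pow (G - E). (-1) ^ card (E \<union> H))"
    by (rule sum.reindex_bij_witness[of _ "\<lambda>H. E \<union> H" "\<lambda>F. F - E"])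
       (use assms(2) in \<open>auto simp: Un_absorb1\<close>)
  also have "\<dots> = (-1) ^ card E * (\<Sum>H\<in>Pow (G - E). (-1) ^ card H)"
    unfolding sum_distrib_left
    by (intro sum.cong refl, subst card_Un_disjoint)
       (use fin assms(1) finite_subset in \<open>auto simp: power_add\<close>)
  also have "(\<Sum>H\<in>Pow (G - E). (-1::real) ^ card H) = (\<Prod>x\<in>G - E. 1 - 1)"
    using assms(1) by (subst prod_diff_conv_sum) auto
  also have "\<dots> = (if E = G then 1 else 0)"
    using assms by (auto simp: prod_constant)
  finally show ?thesis by simp
qed

text \<open>A set of primes stands for the squarefree modulus \<open>\<Prod>E\<close>, and
  \<open>D\<close> is a divisor-closed family of moduli. Thus \<open>L\<close> is the sum of
  1/phi(d) and \<open>R\<close> the sum of sigma(d)/phi(d). The indicator of the sifted set is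
  majorized by the square of a weighted sum with weight 1 at the empty set. The main term is a
  quadratic form in the weights with value \<open>1 / L\<close> at the optimum; the rounding errors
  add up to at most the square of the sum of the absolute weights.\<close>

theorem selberg_sieve:
  fixes P :: "nat set" and a :: "nat \<Rightarrow> nat" and D :: "nat set set" and X :: nat
  assumes fin: "finite P" and pr: "\<And>p. p \<in> P \<Longrightarrow> prime p"
    and D: "D \<subseteq> Pow P" "{} \<in> D" "\<And>E F. F \<in> D \<Longrightarrow> E \<subseteq> F \<Longrightarrow> E \<in> D"
  defines "L \<equiv> \<Sum>E\<in>D. \<Prod>p\<in>E. 1 / (real p - 1)"
    and "R \<equiv> \<Sum>E\<in>D. \<Prod>p\<in>E. (real p + 1) / (real p - 1)"
  shows "real (card {t. t < X \<and> (\<forall>p\<in>P. \<not> [t = a p] (mod p))}) \<le> real X / L + (R / L)\<^sup>2"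
proof -
  define w where "w E = (\<Prod>p\<in>E. 1 / (real p - 1))" for E :: "nat set"
  define m where "m E = (\<Prod>p\<in>E. real p)" for E :: "nat set"
  define f where "f E = (\<Prod>p\<in>E. real p - 1)" for E :: "nat set"
  \<comment> \<open>Selberg's optimal weights: mu(d) d / \<open>L\<close> times the sum of 1/phi(e)
    over the multiples e of d in \<open>D\<close>.\<close>
  define lam where "lam F = (-1) ^ card F * m F * ((\<Sum>E | E \<in> D \<and> F \<subseteq> E. w E) / L)" for F
  define bad where "bad F t \<longleftrightarrow> (\<forall>p\<in>F. [t = a p] (mod p))" for F t
  have finD: "finite D" using D(1) fin finite_subset by auto
  have finE: "finite E" if "E \<in> D" for E using that D(1) fin finite_subset by blast
  have gt1: "real p > 1" if "p \<in> E" "E \<in> D" for p E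
  proof -
    have "p \<in> P" using that D(1) by blast
    then show ?thesis using prime_gt_1_nat[OF pr] by simp
  qed
  have wpos: "w E > 0" if "E \<in> D" for E unfolding w_def using gt1 that by (intro prod_pos) auto
  have mpos: "m E > 0" if "E \<in> D" for E unfolding m_def using gt1[OF _ that] by (intro prod_pos) fastforce
  have fw: "f E * w E = 1" if "E \<in> D" for E
    unfolding f_def w_def prod.distrib[symmetric] using gt1[OF _ that] by (intro prod.neutral ballI) (simp add: less_imp_neq[symmetric])
  have L: "L > 0" unfolding L_def w_def[symmetric] using wpos D(2) finD by (intro sum_pos) auto
  have Lw: "L = sum w D" by (simp add: L_def w_def)
  have lam1: "lam {} = 1" using L by (simp add: lam_def m_def Lw)
  \<comment> \<open>This separates \<open>F\<close> from \<open>G\<close>: 1/lcm equals gcd over the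
    product, and the gcd is the sum of phi over the common divisors.\<close>
  have mUn: "1 / m (F \<union> G) = (\<Sum>E | E \<in> D \<and> E \<subseteq> F \<and> E \<subseteq> G. f E) / (m F * m G)"
    if "F \<in> D" "G \<in> D" for F G
  proof -
    have "m (F \<union> G) * m (F \<inter> G) = m F * m G"
      unfolding m_def using finE that by (intro prod.union_inter) auto
    moreover have "(\<Prod>p\<in>F \<inter> G. (real p - 1) + 1) = (\<Sum>E\<in>Pow (F \<inter> G). f E)"
      by (subst prod_add) (use finE that in \<open>auto simp: f_def\<close>)
    then have "m (F \<inter> G) = (\<Sum>E\<in>Pow (F \<inter> G). f E)" by (simp add: m_def)
    moreover have "Pow (F \<inter> G) = {E. E \<in> D \<and> E \<subseteq> F \<and> E \<subseteq> G}" using D(3) that by auto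
    moreover have "m (F \<union> G) > 0" unfolding m_def
      using gt1[OF _ that(1)] gt1[OF _ that(2)] by (intro prod_pos) fastforce
    ultimately show ?thesis using mpos[OF that(1)] mpos[OF that(2)] by (auto simp: field_simps)
  qed
  \<comment> \<open>These are the variables in which the quadratic form is diagonal; Moebius
    inversion evaluates them at the chosen weights.\<close>
  have y: "(\<Sum>F | F \<in> D \<and> E \<subseteq> F. lam F / m F) = (-1) ^ card E * w E / L" if E: "E \<in> D" for E
  proof -
    have "(\<Sum>F | F \<in> D \<and> E \<subseteq> F. lam F / m F) =
        (\<Sum>F | F \<in> D \<and> E \<subseteq> F. \<Sum>G | G \<in> D \<and> F \<subseteq> G. (-1) ^ card F * (w G / L))"
      using mpos by (intro sum.cong refl) (force simp: lam_def sum_divide_distrib sum_distrib_left)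
    also have "\<dots> = (\<Sum>G\<in>D. \<Sum>F | F \<in> {F. F \<in> D \<and> E \<subseteq> F} \<and> F \<subseteq> G. (-1) ^ card F * (w G / L))"
      using finD by (intro sum.swap_restrict) auto
    also have "\<dots> = (\<Sum>G\<in>D. if E = G then (-1) ^ card E * (w E / L) else 0)"
    proof (intro sum.cong refl)
      fix G assume G: "G \<in> D"
      have "{F. F \<in> {F. F \<in> D \<and> E \<subseteq> F} \<and> F \<subseteq> G} = {F. E \<subseteq> F \<and> F \<subseteq> G}" using D(3) G by auto
      then have *: "(\<Sum>F | F \<in> {F. F \<in> D \<and> E \<subseteq> F} \<and> F \<subseteq> G. (-1) ^ card F * (w G / L)) =
          (\<Sum>F | E \<subseteq> F \<and> F \<subseteq> G. (-1) ^ card F) * (w G / L)" by (simp only: sum_distrib_right)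
      show "(\<Sum>F | F \<in> {F. F \<in> D \<and> E \<subseteq> F} \<and> F \<subseteq> G. (-1) ^ card F * (w G / L)) =
          (if E = G then (-1) ^ card E * (w E / L) else 0)"
      proof (cases "E \<subseteq> G")
        case True
        show ?thesis unfolding * using sum_alternating_between[OF finE[OF G] True] by simp
      next
        case False
        then have none: "{F. E \<subseteq> F \<and> F \<subseteq> G} = {}" and ne: "E \<noteq> G" by blast+
        show ?thesis unfolding * none using ne by simp
      qed
    qed
    also have "\<dots> = (-1) ^ card E * w E / L" using finD E by simp
    finally show ?thesis .
  qed
  have main: "(\<Sum>F\<in>D. \<Sum>G\<in>D. lam F * lam G / m (F \<union> G)) = 1 / L"
  proof -
    have "(\<Sum>F\<in>D. \<Sum>G\<in>D. lam F * lam G / m (F \<union> G)) =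
       (\<Sum>F\<in>D. \<Sum>G\<in>D. \<Sum>E\<in>D. if E \<subseteq> F \<and> E \<subseteq> G then f E * (lam F / m F) * (lam G / m G) else 0)"
    proof (intro sum.cong refl)
      fix F G assume FG: "F \<in> D" "G \<in> D"
      have "lam F * lam G / m (F \<union> G) = lam F * lam G * (1 / m (F \<union> G))" by simp
      also have "\<dots> = (\<Sum>E | E \<in> D \<and> E \<subseteq> F \<and> E \<subseteq> G. f E * (lam F / m F) * (lam G / m G))"
        unfolding mUn[OF FG] by (simp add: sum_distrib_left sum_divide_distrib mult_ac)
      also have "\<dots> = (\<Sum>E\<in>D. if E \<subseteq> F \<and> E \<subseteq> G then f E * (lam F / m F) * (lam G / m G) else 0)"
        by (rule sum.inter_filter[OF finD])
      finally show "lam F * lam G / m (F \<union> G) = \<dots>" .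
    qed
    also have "\<dots> = (\<Sum>E\<in>D. \<Sum>F\<in>D. \<Sum>G\<in>D.
        if E \<subseteq> F \<and> E \<subseteq> G then f E * (lam F / m F) * (lam G / m G) else 0)"
      by (subst sum.swap[of _ D D], subst (2) sum.swap[of _ D D], rule sum.swap[THEN trans], rule sum.cong[OF refl], rule sum.swap)
    also have "\<dots> = (\<Sum>E\<in>D. f E * (\<Sum>F | F \<in> D \<and> E \<subseteq> F. lam F / m F)\<^sup>2)"
    proof (intro sum.cong refl)
      fix E assume "E \<in> D"
      have "f E * (\<Sum>F | F \<in> D \<and> E \<subseteq> F. lam F / m F)\<^sup>2 =
        f E * ((\<Sum>F\<in>D. if E \<subseteq> F then lam F / m F else 0) * (\<Sum>G\<in>D. if E \<subseteq> G then lam G / m G else 0))"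
        using finD by (simp add: sum.inter_filter power2_eq_square)
      also have "\<dots> = (\<Sum>F\<in>D. \<Sum>G\<in>D.
          f E * ((if E \<subseteq> F then lam F / m F else 0) * (if E \<subseteq> G then lam G / m G else 0)))"
        unfolding sum_product by (simp only: sum_distrib_left)
      also have "\<dots> = (\<Sum>F\<in>D. \<Sum>G\<in>D. if E \<subseteq> F \<and> E \<subseteq> G then f E * (lam F / m F) * (lam G / m G) else 0)"
        by (intro sum.cong refl) auto
      finally show "(\<Sum>F\<in>D. \<Sum>G\<in>D. if E \<subseteq> F \<and> E \<subseteq> G then f E * (lam F / m F) * (lam G / m G) else 0)
         = f E * (\<Sum>F | F \<in> D \<and> E \<subseteq> F. lam F / m F)\<^sup>2" ..
    qed
    \<comment> \<open>Since \<open>f E * w E = 1\<close>, each diagonal term collapses, and the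
      \<open>w E\<close> sum to \<open>L\<close>.\<close>
    also have "\<dots> = (\<Sum>E\<in>D. w E / L\<^sup>2)"
    proof (intro sum.cong refl)
      fix E assume E: "E \<in> D"
      have "f E * ((-1) ^ card E * w E / L)\<^sup>2 = (f E * w E) * w E / L\<^sup>2"
        by (simp add: power2_eq_square power_mult_distrib[symmetric] flip: power_add)
      then show "f E * (\<Sum>F | F \<in> D \<and> E \<subseteq> F. lam F / m F)\<^sup>2 = w E / L\<^sup>2"
        unfolding y[OF E] fw[OF E] by simp
    qed
    also have "\<dots> = 1 / L"
      using L by (simp add: Lw[symmetric] sum_divide_distrib[symmetric] power2_eq_square)
    finally show ?thesis .
  qed
  \<comment> \<open>After interchanging the sums, the divisors of a fixed modulus contribute the
    product of the \<open>p + 1\<close>, and \<open>w E\<close> supplies the denominators of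
    \<open>R\<close>.\<close>
  have abs: "(\<Sum>F\<in>D. \<bar>lam F\<bar>) = R / L"
  proof -
    have "(\<Sum>F\<in>D. \<bar>lam F\<bar>) = (\<Sum>F\<in>D. \<Sum>E | E \<in> D \<and> F \<subseteq> E. m F * w E / L)"
    proof (intro sum.cong refl)
      fix F assume F: "F \<in> D"
      have "(\<Sum>E | E \<in> D \<and> F \<subseteq> E. w E) \<ge> 0" using wpos by (intro sum_nonneg) (auto intro: less_imp_le)
      then have "\<bar>lam F\<bar> = m F * (\<Sum>E | E \<in> D \<and> F \<subseteq> E. w E) / L"
        using mpos[OF F] L by (simp add: lam_def abs_mult power_abs)
      then show "\<bar>lam F\<bar> = (\<Sum>E | E \<in> D \<and> F \<subseteq> E. m F * w E / L)"
        by (simp only: sum_distrib_left sum_divide_distrib)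
    qed
    also have "\<dots> = (\<Sum>E\<in>D. \<Sum>F | F \<in> D \<and> F \<subseteq> E. m F * w E / L)"
      using finD by (intro sum.swap_restrict)
    also have "\<dots> = (\<Sum>E\<in>D. (\<Prod>p\<in>E. (real p + 1) / (real p - 1)) / L)"
    proof (intro sum.cong refl)
      fix E assume E: "E \<in> D"
      have "{F. F \<in> D \<and> F \<subseteq> E} = Pow E" using D(3) E by auto
      then have "(\<Sum>F | F \<in> D \<and> F \<subseteq> E. m F * w E / L) = (\<Sum>F\<in>Pow E. m F) * w E / L"
        by (simp add: sum_distrib_right sum_divide_distrib)
      also have "(\<Sum>F\<in>Pow E. m F) = (\<Prod>p\<in>E. real p + 1)"
        using finE[OF E] by (simp add: prod_add m_def)
      finally show "(\<Sum>F | F \<in> D \<and> F \<subseteq> E. m F * w E / L) = (\<Prod>p\<in>E. (real p + 1) / (real p - 1)) / L"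
        by (simp add: w_def prod.distrib[symmetric])
    qed
    finally show ?thesis by (simp add: R_def sum_divide_distrib)
  qed
  have "real (card {t. t < X \<and> (\<forall>p\<in>P. \<not> [t = a p] (mod p))}) =
      (\<Sum>t<X. if \<forall>p\<in>P. \<not> [t = a p] (mod p) then 1 else 0)"
    by (simp add: sum.If_cases lessThan_def Collect_conj_eq)
  \<comment> \<open>At a sifted \<open>t\<close> only the empty set is bad, so the inner sum is
    \<open>lam {} = 1\<close>; at any other \<open>t\<close> the square is nonnegative.\<close>
  also have "\<dots> \<le> (\<Sum>t<X. (\<Sum>F\<in>D. if bad F t then lam F else 0)\<^sup>2)"
  proof (intro sum_mono)
    fix t
    have "(\<Sum>F\<in>D. if bad F t then lam F else 0) = 1" if t: "\<forall>p\<in>P. \<not> [t = a p] (mod p)"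
    proof -
      have "bad F t \<longleftrightarrow> F = {}" if "F \<in> D" for F using t that D(1) by (auto simp: bad_def)
      then have "(\<Sum>F\<in>D. if bad F t then lam F else 0) = (\<Sum>F\<in>D. if F = {} then lam {} else 0)"
        by (intro sum.cong) auto
      then show ?thesis using finD D(2) lam1 by simp
    qed
    then show "(if \<forall>p\<in>P. \<not> [t = a p] (mod p) then 1 else 0) \<le> (\<Sum>F\<in>D. if bad F t then lam F else 0)\<^sup>2"
      by auto
  qed
  also have "\<dots> = (\<Sum>t<X. \<Sum>F\<in>D. \<Sum>G\<in>D. if bad (F \<union> G) t then lam F * lam G else 0)"
    by (intro sum.cong refl, unfold power2_eq_square sum_product)
       (intro sum.cong refl, auto simp: bad_def)
  also have "\<dots> = (\<Sum>F\<in>D. \<Sum>G\<in>D. \<Sum>t<X. if bad (F \<union> G) t then lam F * lam G else 0)"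
    by (rule sum.swap[THEN trans], rule sum.cong[OF refl], rule sum.swap)
  also have "\<dots> = (\<Sum>F\<in>D. \<Sum>G\<in>D. lam F * lam G * real (card {t. t < X \<and> bad (F \<union> G) t}))"
    by (simp add: sum.If_cases lessThan_def Collect_conj_eq mult_ac)
  also have "\<dots> \<le> (\<Sum>F\<in>D. \<Sum>G\<in>D. real X * (lam F * lam G / m (F \<union> G)) + \<bar>lam F\<bar> * \<bar>lam G\<bar>)"
  proof (intro sum_mono)
    fix F G assume FG: "F \<in> D" "G \<in> D"
    have "\<bar>real (card {t. t < X \<and> bad (F \<union> G) t}) - real X / real (\<Prod>(F \<union> G))\<bar> \<le> 1"
    proof -
      have "finite (F \<union> G)" "F \<union> G \<subseteq> P" using FG finE D(1) by auto
      then show ?thesis unfolding bad_def using pr by (intro card_simultaneous_residues_bounds) blast+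
    qed
    then have r: "\<bar>real (card {t. t < X \<and> bad (F \<union> G) t}) - real X / m (F \<union> G)\<bar> \<le> 1"
      by (simp add: m_def of_nat_prod)
    have "lam F * lam G * (real (card {t. t < X \<and> bad (F \<union> G) t}) - real X / m (F \<union> G))
       \<le> \<bar>lam F * lam G\<bar> * \<bar>real (card {t. t < X \<and> bad (F \<union> G) t}) - real X / m (F \<union> G)\<bar>"
      by (metis abs_ge_self abs_mult)
    also have "\<dots> \<le> \<bar>lam F * lam G\<bar> * 1" using r by (intro mult_left_mono) auto
    finally show "lam F * lam G * real (card {t. t < X \<and> bad (F \<union> G) t}) \<le>
        real X * (lam F * lam G / m (F \<union> G)) + \<bar>lam F\<bar> * \<bar>lam G\<bar>"
      by (simp add: abs_mult algebra_simps)
  qed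
  also have "\<dots> = real X * (\<Sum>F\<in>D. \<Sum>G\<in>D. lam F * lam G / m (F \<union> G)) + (\<Sum>F\<in>D. \<bar>lam F\<bar>)\<^sup>2"
    unfolding power2_eq_square sum_product by (simp only: sum.distrib sum_distrib_left)
  finally show ?thesis unfolding main abs by simp
qed

section \<open>Sums over integers coprime to 6\<close>

definition coprime6_upto :: "nat \<Rightarrow> nat set" where
  "coprime6_upto z = {d. d \<le> z \<and> (d mod 6 = 1 \<or> d mod 6 = 5)}"

lemma finite_coprime6_upto [simp]: "finite (coprime6_upto z)"
  by (rule finite_subset[of _ "{..z}"]) (auto simp: coprime6_upto_def)

lemma coprime6_upto_iff: "d \<in> coprime6_upto z \<longleftrightarrow> d \<le> z \<and> \<not> 2 dvd d \<and> \<not> 3 dvd d"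
  unfolding coprime6_upto_def by simp presburger

lemma coprime6_upto_pos: "d \<in> coprime6_upto z \<Longrightarrow> d > 0"
  unfolding coprime6_upto_def by (auto intro: Nat.gr0I)

text \<open>Integers coprime to 6 jump from \<open>6 * k + 1\<close> to \<open>6 * k + 5\<close> to
  \<open>6 * k + 7\<close> with nothing in between, so a sum over them changes only at these
  points.\<close>

lemma coprime6_le_iff:
  fixes d k z :: nat
  assumes "d mod 6 = 1 \<or> d mod 6 = 5"
  shows "6 * k + 1 \<le> z \<Longrightarrow> z < 6 * k + 5 \<Longrightarrow> d \<le> z \<longleftrightarrow> d \<le> 6 * k + 1"
    and "6 * k + 5 \<le> z \<Longrightarrow> z < 6 * k + 7 \<Longrightarrow> d \<le> z \<longleftrightarrow> d = 6 * k + 5 \<or> d \<le> 6 * k + 1"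
    and "d \<le> 6 * k + 7 \<longleftrightarrow> d = 6 * k + 7 \<or> d \<le> 6 * k + 5"
proof -
  define q where "q = d div 6"
  have d: "d = 6 * q + 1 \<or> d = 6 * q + 5"
    using assms div_mult_mod_eq[of d 6] unfolding q_def by linarith
  have q: "q < k \<or> q = k \<or> q > k" by linarith
  show "6 * k + 1 \<le> z \<Longrightarrow> z < 6 * k + 5 \<Longrightarrow> d \<le> z \<longleftrightarrow> d \<le> 6 * k + 1"
    using d q by (elim disjE) auto
  show "6 * k + 5 \<le> z \<Longrightarrow> z < 6 * k + 7 \<Longrightarrow> d \<le> z \<longleftrightarrow> d = 6 * k + 5 \<or> d \<le> 6 * k + 1"
    using d q by (elim disjE) auto
  consider "q \<le> k" | "q = Suc k" | "q > Suc k" by linarith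
  then show "d \<le> 6 * k + 7 \<longleftrightarrow> d = 6 * k + 7 \<or> d \<le> 6 * k + 5"
    using d by cases auto
qed

lemma coprime6_upto_1: "coprime6_upto (Suc 0) = {1}"
  by (auto simp: coprime6_upto_def le_Suc_eq)

lemma coprime6_upto_5:
  assumes "6 * k + 5 \<le> z" "z < 6 * k + 7"
  shows "coprime6_upto z = insert (6 * k + 5) (coprime6_upto (6 * k + 1))"
  using coprime6_le_iff(2)[OF _ assms] by (auto simp: coprime6_upto_def)

lemma coprime6_upto_7: "coprime6_upto (6 * k + 7) = insert (6 * k + 7) (coprime6_upto (6 * k + 5))"
proof -
  have "(6 * k + 7) mod 6 = 1" by simp
  then show ?thesis using coprime6_le_iff(3)[of _ k] unfolding coprime6_upto_def by blast
qed

lemma sum_coprime6_upto_5: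
  "sum f (coprime6_upto (6 * k + 5)) = sum f (coprime6_upto (6 * k + 1)) + (f (6 * k + 5) :: real)"
  by (subst coprime6_upto_5[of k], simp, simp, subst sum.insert) (auto simp: coprime6_upto_def)

lemma sum_coprime6_upto_7:
  "sum f (coprime6_upto (6 * k + 7)) =
     sum f (coprime6_upto (6 * k + 1)) + (f (6 * k + 5) :: real) + f (6 * k + 7)"
proof -
  have "6 * k + 7 \<notin> coprime6_upto (6 * k + 5)" by (simp add: coprime6_upto_def)
  then show ?thesis
    unfolding coprime6_upto_7 by (simp only: sum.insert finite_coprime6_upto not_False_eq_True sum_coprime6_upto_5)
qed

lemma coprime6_upto_cases:
  assumes "z \<ge> 1"
  obtains (low) k where "6 * k + 1 \<le> z" "z < 6 * k + 5" "coprime6_upto z = coprime6_upto (6 * k + 1)"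
  | (high) k where "6 * k + 5 \<le> z" "z < 6 * k + 7" "coprime6_upto z = coprime6_upto (6 * k + 5)"
proof -
  define k where "k = (z - 1) div 6"
  have k: "6 * k + 1 \<le> z" "z < 6 * k + 7" using assms unfolding k_def by presburger+
  show ?thesis
  proof (cases "z < 6 * k + 5")
    case True
    then have "coprime6_upto z = coprime6_upto (6 * k + 1)"
      using coprime6_le_iff(1)[OF _ k(1)] unfolding coprime6_upto_def by blast
    then show ?thesis using low[of k] k(1) True by simp
  next
    case False
    then have "coprime6_upto z = coprime6_upto (6 * k + 5)"
      using k(2) coprime6_upto_5[of k z] coprime6_upto_5[of k "6 * k + 5"] by simp
    then show ?thesis using high[of k] k(2) False by simp
  qed
qed

text \<open>The count grows by 2 per block of six, and the bound is attained at
  \<open>z = 6 * k + 1\<close>.\<close>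

lemma card_coprime6_upto:
  assumes "z \<ge> 1"
  shows "real (card (coprime6_upto z)) \<le> (real z + 2) / 3"
proof -
  have *: "(\<Sum>d\<in>coprime6_upto (6 * k + 1). 1 :: real) \<le> (6 * real k + 3) / 3" for k
  proof (induction k)
    case (Suc k)
    then show ?case using sum_coprime6_upto_7[of "\<lambda>_. 1" k] by (simp add: add.commute)
  qed (simp add: coprime6_upto_1)
  show ?thesis
    using assms
  proof (cases rule: coprime6_upto_cases)
    case (low k)
    then have "6 * real k + 1 \<le> real z" by linarith
    then show ?thesis using *[of k] unfolding low by simp
  next
    case (high k)
    then have "6 * real k + 5 \<le> real z" by linarith
    then show ?thesis using *[of k] sum_coprime6_upto_5[of "\<lambda>_. 1" k] unfolding high by simp
  qed
qed

text \<open>The right side is the mean of the decreasing function 1/sqrt on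
  \<open>[y, y + 3]\<close>, an interval to the left of \<open>x\<close>. Its length 3 is the
  average gap between integers coprime to 6.\<close>

lemma inverse_sqrt_le_diff:
  fixes x y :: real
  assumes "y \<ge> 0" "y + 3 \<le> x"
  shows "1 / sqrt x \<le> 2 / 3 * (sqrt (y + 3) - sqrt y)"
proof -
  have pos: "sqrt (y + 3) > 0" using assms by simp
  have "(sqrt (y + 3) - sqrt y) * (sqrt (y + 3) + sqrt y) = 3"
    using assms by (simp add: algebra_simps)
  moreover have "sqrt y \<le> sqrt (y + 3)" by simp
  ultimately have "3 \<le> (sqrt (y + 3) - sqrt y) * (2 * sqrt (y + 3))"
    by (smt (verit) mult_left_mono)
  then have "1 / sqrt (y + 3) \<le> 2 / 3 * (sqrt (y + 3) - sqrt y)"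
    using pos by (simp add: field_simps)
  moreover have "1 / sqrt x \<le> 1 / sqrt (y + 3)" using assms pos by (simp add: frac_le)
  ultimately show ?thesis by linarith
qed

text \<open>The intervals from \<open>6 * k + 1\<close> to \<open>6 * k + 4\<close> and on to
  \<open>6 * k + 7\<close> pay for the terms at \<open>6 * k + 5\<close> and
  \<open>6 * k + 7\<close>, and the bounds telescope from the term 1 = 2/3 + 1/3.\<close>

lemma sum_inverse_sqrt_coprime6_upto:
  assumes "z \<ge> 1"
  shows "(\<Sum>d\<in>coprime6_upto z. 1 / sqrt (real d)) \<le> 2 / 3 * sqrt (real z) + 1 / 3"
proof -
  let ?S = "\<lambda>z. \<Sum>d\<in>coprime6_upto z. 1 / sqrt (real d)"
  have s5: "1 / sqrt (real (6 * k + 5)) \<le> 2 / 3 * (sqrt (6 * real k + 4) - sqrt (6 * real k + 1))" for k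
    using inverse_sqrt_le_diff[of "6 * real k + 1" "real (6 * k + 5)"] by (simp add: add_ac)
  have s7: "1 / sqrt (real (6 * k + 7)) \<le> 2 / 3 * (sqrt (6 * real k + 7) - sqrt (6 * real k + 4))" for k
    using inverse_sqrt_le_diff[of "6 * real k + 4" "real (6 * k + 7)"] by (simp add: add_ac)
  have *: "?S (6 * k + 1) \<le> 2 / 3 * sqrt (6 * real k + 1) + 1 / 3" for k
  proof (induction k)
    case (Suc k)
    have "?S (6 * Suc k + 1) = ?S (6 * k + 7)" by (simp add: add.commute)
    also have "\<dots> \<le> 2 / 3 * sqrt (6 * real k + 7) + 1 / 3"
      using sum_coprime6_upto_7[of "\<lambda>d. 1 / sqrt (real d)" k] Suc s5[of k] s7[of k]
      unfolding right_diff_distrib by linarith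
    also have "6 * real k + 7 = 6 * real (Suc k) + 1" by simp
    finally show ?case .
  qed (simp add: coprime6_upto_1)
  show ?thesis
    using assms
  proof (cases rule: coprime6_upto_cases)
    case (low k)
    then have "sqrt (6 * real k + 1) \<le> sqrt (real z)" by simp
    then show ?thesis using *[of k] unfolding low by linarith
  next
    case (high k)
    then have "sqrt (6 * real k + 4) \<le> sqrt (real z)" by simp
    then show ?thesis
      using *[of k] s5[of k] sum_coprime6_upto_5[of "\<lambda>d. 1 / sqrt (real d)" k]
      unfolding high right_diff_distrib by linarith
  qed
qed

text \<open>The difference of the two sides has derivative \<open>(1 - 1 / t)\<^sup>2 / 2\<close>.
  The bound agrees with \<open>ln\<close> to second order at 1, which \<open>x - 1\<close> does
  not.\<close>

lemma ln_le_half_diff_inverse: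
  fixes x :: real
  assumes "x \<ge> 1"
  shows "ln x \<le> (x - 1 / x) / 2"
proof -
  have "(\<lambda>x. (x - 1 / x) / 2 - ln x) 1 \<le> (\<lambda>x. (x - 1 / x) / 2 - ln x) x"
  proof (rule DERIV_nonneg_imp_nondecreasing[OF assms])
    fix t :: real assume t: "1 \<le> t" "t \<le> x"
    have "((\<lambda>x. (x - 1 / x) / 2 - ln x) has_real_derivative (1 + 1 / t\<^sup>2) / 2 - 1 / t) (at t)"
      using t by (auto intro!: derivative_eq_intros simp: power2_eq_square field_simps)
    moreover have "(1 + 1 / t\<^sup>2) / 2 - 1 / t = (1 - 1 / t)\<^sup>2 / 2"
      using t by (simp add: power2_eq_square field_simps)
    ultimately show "\<exists>y. ((\<lambda>x. (x - 1 / x) / 2 - ln x) has_real_derivative y) (at t) \<and> 0 \<le> y" by auto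
  qed
  then show ?thesis by simp
qed

section \<open>Numerical bounds for exp and ln\<close>

lemma exp_partial_sum_le:
  fixes x :: real
  assumes "x \<ge> 0"
  shows "(\<Sum>n<N. x ^ n / fact n) \<le> exp x"
proof -
  have "(\<Sum>n<N. inverse (fact n) * x ^ n) \<le> (\<Sum>n. inverse (fact n) * x ^ n)"
    using assms by (intro sum_le_suminf summable_exp) auto
  then show ?thesis by (simp add: exp_def divide_inverse mult.commute)
qed

lemma exp_1_ge: "exp (1::real) \<ge> 27182 / 10000"
  using exp_partial_sum_le[of 1 9] by (simp add: eval_nat_numeral)

text \<open>The start of the induction for the sum of \<open>1 / d\<close>: there
  \<open>k = 6\<close> and \<open>3 * (6 * 6 + 5) = 123\<close>.\<close>

lemma ln_123_le: "ln 123 \<le> (483 / 100 :: real)"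
proof -
  have "exp (83 / 100 :: real) \<ge> 2285 / 1000"
    using exp_partial_sum_le[of "83 / 100" 5] by (simp add: eval_nat_numeral)
  moreover have "exp (4::real) \<ge> (27182 / 10000) ^ 4"
    using power_mono[OF exp_1_ge, of 4] by (simp flip: exp_of_nat_mult)
  ultimately have "exp (4::real) * exp (83 / 100) \<ge> (27182 / 10000) ^ 4 * (2285 / 1000)"
    by (intro mult_mono) auto
  then have "exp (483 / 100 :: real) \<ge> 123" by (simp add: power_divide flip: exp_add)
  then show ?thesis by (metis ln_exp ln_le_cancel_iff exp_gt_zero zero_less_numeral)
qed

text \<open>The argument \<open>3 * (z + 1)\<close> is tailored to a sieve level \<open>z\<close>
  near sqrt(Y)/3, for which the logarithm is at least that of sqrt(Y). The surplus 13/20 is the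
  secondary term that later outweighs the sieve error.\<close>

lemma sum_inverse_coprime6_upto:
  assumes "z \<ge> 37"
  shows "ln (3 * (real z + 1)) + 13 / 20 \<le> 3 * (\<Sum>d\<in>coprime6_upto z. 1 / real d)"
proof -
  let ?S = "\<lambda>z. \<Sum>d\<in>coprime6_upto z. 1 / real d"
  \<comment> \<open>The value \<open>6 * k + 5\<close> is the largest \<open>z + 1\<close> for which
    the sum is still that of \<open>6 * k + 1\<close>.\<close>
  have *: "ln (3 * (6 * real k + 5)) + 13 / 20 \<le> 3 * ?S (6 * k + 1)" if "k \<ge> 6" for k
    using that
  proof (induction k rule: dec_induct)
    case base
    have "?S 37 = 1 + 1/5 + 1/7 + 1/11 + 1/13 + 1/17 + 1/19 + 1/23 + 1/25 + 1/29 + 1/31 + 1/35 + 1/37"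
      using sum_coprime6_upto_7[of "\<lambda>d. 1 / real d" 0] sum_coprime6_upto_7[of "\<lambda>d. 1 / real d" 1]
        sum_coprime6_upto_7[of "\<lambda>d. 1 / real d" 2] sum_coprime6_upto_7[of "\<lambda>d. 1 / real d" 3]
        sum_coprime6_upto_7[of "\<lambda>d. 1 / real d" 4] sum_coprime6_upto_7[of "\<lambda>d. 1 / real d" 5]
      by (simp add: coprime6_upto_1)
    then show ?case using ln_123_le by simp
  next
    case (step k)
    \<comment> \<open>The midpoint: the logarithm moves from \<open>c - 3\<close> to
      \<open>c + 3\<close>, while the new terms are \<open>1 / (c - 3)\<close> and
      \<open>1 / (c - 1)\<close>.\<close>
    define c where "c = 6 * real k + 8"
    have c: "c \<ge> 8" by (simp add: c_def)
    have eqs: "6 * real (Suc k) + 5 = c + 3" "6 * real k + 5 = c - 3" by (simp_all add: c_def)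
    have "ln (3 * (6 * real (Suc k) + 5)) - ln (3 * (6 * real k + 5)) = ln ((c + 3) / (c - 3))"
      unfolding eqs using c by (subst ln_divide_pos[symmetric]) (auto simp: divide_simps algebra_simps)
    also have "\<dots> \<le> ((c + 3) / (c - 3) - 1 / ((c + 3) / (c - 3))) / 2"
      using c by (intro ln_le_half_diff_inverse) simp
    also have "\<dots> = 6 * c / ((c - 3) * (c + 3))" using c by (simp add: divide_simps) (simp add: algebra_simps)
    also have "\<dots> \<le> 6 * (c - 2) / ((c - 3) * (c - 1))"
    proof -
      have "c * (c - 1) \<le> (c - 2) * (c + 3)" using c by (simp add: algebra_simps)
      then have "c / (c + 3) \<le> (c - 2) / (c - 1)" using c by (simp add: field_simps)
      then have "6 / (c - 3) * (c / (c + 3)) \<le> 6 / (c - 3) * ((c - 2) / (c - 1))"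
        using c by (intro mult_left_mono) auto
      then show ?thesis by simp
    qed
    also have "\<dots> = 3 * (1 / real (6 * k + 5) + 1 / real (6 * k + 7))"
      using c by (simp add: c_def field_simps)
    finally have "ln (3 * (6 * real (Suc k) + 5)) - ln (3 * (6 * real k + 5)) \<le>
       3 * (1 / real (6 * k + 5) + 1 / real (6 * k + 7))" .
    then show ?case
      using step.IH sum_coprime6_upto_7[of "\<lambda>d. 1 / real d" k] by (simp add: add.commute)
  qed
  have "z \<ge> 1" using assms by simp
  then show ?thesis
  proof (cases rule: coprime6_upto_cases)
    case (low k)
    then have "k \<ge> 6" using assms by simp
    moreover have "ln (3 * (real z + 1)) \<le> ln (3 * (6 * real k + 5))" using low by simp
    ultimately show ?thesis using *[of k] unfolding low by linarith
  next
    case (high k)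
    then have k: "k \<ge> 6" using assms by simp
    \<comment> \<open>The logarithm grows by at most 2/(6k+5) past the induction bound, less than
      the new term 3/(6k+5).\<close>
    have "ln (3 * (real z + 1)) \<le> ln (3 * (6 * real k + 7))" using high by simp
    also have "\<dots> = ln (3 * (6 * real k + 5)) + ln (1 + 2 / (6 * real k + 5))"
      by (subst ln_mult_pos[symmetric]) (auto simp: field_simps add_pos_nonneg)
    also have "ln (1 + 2 / (6 * real k + 5)) \<le> 2 / (6 * real k + 5)" by (intro ln_add_one_self_le_self) simp
    also have "\<dots> \<le> 3 * (1 / real (6 * k + 5))" by (simp add: field_simps)
    finally show ?thesis
      using *[OF k] sum_coprime6_upto_5[of "\<lambda>d. 1 / real d" k] unfolding high by linarith
  qed
qed

section \<open>Sums over sets of primes with bounded product\<close>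

text \<open>Encodes the squarefree integers up to \<open>z\<close> coprime to 6 by their sets of
  prime factors, in the shape in which the sieve takes its moduli.\<close>

definition prime_sets_upto :: "nat \<Rightarrow> nat set set" where
  "prime_sets_upto z = {E. E \<subseteq> {p. prime p \<and> 5 \<le> p \<and> p \<le> z} \<and> \<Prod>E \<le> z}"

lemma prime_sets_uptoD:
  assumes "E \<in> prime_sets_upto z"
  shows "finite E" "\<And>p. p \<in> E \<Longrightarrow> prime p" "\<And>p. p \<in> E \<Longrightarrow> 5 \<le> p" "\<Prod>E \<le> z" "\<Prod>E > 0"
proof -
  show fin: "finite E" using assms unfolding prime_sets_upto_def
    by (auto intro: finite_subset[of _ "{..z}"])
  show pr: "prime p" "5 \<le> p" if "p \<in> E" for p using assms that unfolding prime_sets_upto_def by auto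
  show "\<Prod>E \<le> z" using assms unfolding prime_sets_upto_def by auto
  show "\<Prod>E > 0" using pr(1) prime_gt_0_nat by (intro prod_pos) auto
qed

lemma finite_prime_sets_upto: "finite (prime_sets_upto z)"
  by (rule finite_subset[of _ "Pow {..z}"]) (auto simp: prime_sets_upto_def)

lemma prime_sets_upto_downward:
  assumes "F \<in> prime_sets_upto z" "E \<subseteq> F"
  shows "E \<in> prime_sets_upto z"
proof -
  note F = prime_sets_uptoD[OF assms(1)]
  have "\<Prod>E dvd \<Prod>F" using assms(2) F(1) by (intro prod_dvd_prod_subset)
  then have "\<Prod>E \<le> \<Prod>F" using F(5) by (intro dvd_imp_le)
  then show ?thesis using assms F(4) unfolding prime_sets_upto_def by auto
qed

section \<open>Squarefree numbers as sets of primes\<close>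

lemma prime_dvd_prod_primes_iff:
  fixes E :: "nat set"
  assumes "finite E" "\<And>p. p \<in> E \<Longrightarrow> prime p" "prime q"
  shows "q dvd \<Prod>E \<longleftrightarrow> q \<in> E"
  unfolding prime_dvd_prod_iff[OF assms(1,3)]
proof
  assume "\<exists>p\<in>E. q dvd p"
  then obtain p where "p \<in> E" "q dvd p" by blast
  then show "q \<in> E" using primes_dvd_imp_eq[OF assms(3) assms(2)] by blast
qed (use dvd_refl in blast)

lemma inj_on_Prod_primes:
  "inj_on (\<lambda>E :: nat set. \<Prod>E) {E. finite E \<and> (\<forall>p\<in>E. prime p)}"
proof (rule inj_onI)
  fix E F :: "nat set"
  assume *: "E \<in> {E. finite E \<and> (\<forall>p\<in>E. prime p)}" "F \<in> {E. finite E \<and> (\<forall>p\<in>E. prime p)}" "\<Prod>E = \<Prod>F"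
  have "p \<in> E \<longleftrightarrow> p \<in> F" if "prime p" for p
    using prime_dvd_prod_primes_iff[of E p] prime_dvd_prod_primes_iff[of F p] * that by auto
  then show "E = F" using *(1,2) by blast
qed

lemma Prod_primes_in_coprime6_upto:
  assumes "finite E" "\<And>p. p \<in> E \<Longrightarrow> prime p" "\<And>p. p \<in> E \<Longrightarrow> 5 \<le> p" "\<Prod>E \<le> z"
  shows "\<Prod>E \<in> coprime6_upto z"
proof -
  have "2 \<notin> E" "3 \<notin> E" using assms(3)[of 2] assms(3)[of 3] by auto
  then show ?thesis
    using assms(4) prime_dvd_prod_primes_iff[OF assms(1,2), of 2] prime_dvd_prod_primes_iff[OF assms(1,2), of 3]
    unfolding coprime6_upto_iff by auto
qed

text \<open>Each factor on the right is the geometric series of \<open>p ^ (-k)\<close> over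
  \<open>k \<ge> 1\<close>. Multiplied out, the product contains \<open>1 / m\<close> once for every
  \<open>m\<close> with prime factors exactly \<open>E\<close>.\<close>

lemma sum_inverse_same_prime_factors:
  fixes M E :: "nat set"
  assumes M: "finite M" "\<And>m. m \<in> M \<Longrightarrow> m > 0 \<and> prime_factors m = E"
    and E: "finite E" "\<And>p. p \<in> E \<Longrightarrow> prime p"
  shows "(\<Sum>m\<in>M. 1 / real m) \<le> (\<Prod>p\<in>E. 1 / (real p - 1))"
proof -
  \<comment> \<open>A common bound for all exponents that occur, because
    \<open>multiplicity p m < p ^ multiplicity p m \<le> m \<le> K\<close>; it truncates the series
    to finite sums.\<close>
  define K where "K = \<Sum>M"
  define e where "e m = restrict (\<lambda>p. multiplicity p m) E" for m :: nat
  have fact: "m = (\<Prod>p\<in>E. p ^ e m p)" if "m \<in> M" for m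
    using M(2)[OF that] prime_factorization_nat[of m] by (simp add: e_def)
  have inj: "inj_on e M" by (rule inj_onI) (metis fact)
  have range: "e ` M \<subseteq> PiE E (\<lambda>_. {1..K})"
  proof -
    have "multiplicity p m \<in> {1..K}" if "m \<in> M" "p \<in> E" for m p
    proof -
      have m: "m > 0" "p \<in> prime_factors m" using M(2) that by auto
      have p: "prime p" using E that by auto
      have "p ^ multiplicity p m \<le> m" using m by (intro dvd_imp_le multiplicity_dvd) auto
      moreover have "multiplicity p m < p ^ multiplicity p m"
        using prime_gt_1_nat[OF p] by (intro power_gt_expt) auto
      moreover have "m \<le> K" unfolding K_def using M(1) that by (intro member_le_sum) auto
      moreover have "multiplicity p m > 0" using m by (simp add: prime_factors_multiplicity)
      ultimately show ?thesis by simp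
    qed
    then show ?thesis by (auto simp: e_def)
  qed
  have "(\<Sum>m\<in>M. 1 / real m) = (\<Sum>m\<in>M. \<Prod>p\<in>E. (1 / real p) ^ e m p)"
  proof (intro sum.cong refl)
    fix m assume "m \<in> M"
    then have "real m = (\<Prod>p\<in>E. real p ^ e m p)" by (subst fact) auto
    then show "1 / real m = (\<Prod>p\<in>E. (1 / real p) ^ e m p)"
      by (simp add: prod_dividef power_divide)
  qed
  also have "\<dots> = (\<Sum>h\<in>e ` M. \<Prod>p\<in>E. (1 / real p) ^ h p)"
    using inj by (simp add: sum.reindex)
  also have "\<dots> \<le> (\<Sum>h\<in>PiE E (\<lambda>_. {1..K}). \<Prod>p\<in>E. (1 / real p) ^ h p)"
    using range E(1) by (intro sum_mono2 finite_PiE) (auto intro!: prod_nonneg)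
  also have "\<dots> = (\<Prod>p\<in>E. \<Sum>k\<in>{1..K}. (1 / real p) ^ k)"
    using E(1) by (intro prod_sum_PiE[symmetric]) auto
  also have "\<dots> \<le> (\<Prod>p\<in>E. 1 / (real p - 1))"
  proof (intro prod_mono conjI)
    fix p assume p: "p \<in> E"
    then have p1: "real p > 1" using E(2) prime_gt_1_nat by (metis of_nat_1 of_nat_less_iff)
    show "0 \<le> (\<Sum>k\<in>{1..K}. (1 / real p) ^ k)" by (intro sum_nonneg) auto
    have "(\<Sum>k\<in>{1..n}. (1 / real p) ^ k) = (1 - (1 / real p) ^ n) / (real p - 1)" for n
    proof (induction n)
      case (Suc n)
      define x where "x = 1 / real p"
      have "x * real p = 1" using p1 by (simp add: x_def)
      then have "x ^ n = x ^ n * (x * real p)" by simp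
      then have "(1 - x ^ n) / (real p - 1) + x ^ Suc n = (1 - x ^ Suc n) / (real p - 1)"
        using p1 by (simp add: field_simps)
      then show ?case using Suc by (simp add: x_def)
    qed simp
    also have "(1 - (1 / real p) ^ n) / (real p - 1) \<le> 1 / (real p - 1)" for n
      using p1 by (intro divide_right_mono) auto
    finally show "(\<Sum>k\<in>{1..K}. (1 / real p) ^ k) \<le> 1 / (real p - 1)" .
  qed
  finally show ?thesis .
qed

text \<open>Group the \<open>d\<close> by their sets of prime factors; the product of the primes
  dividing \<open>d\<close> is at most \<open>d\<close>, so each group belongs to an admissible
  set.\<close>

lemma sum_prime_sets_ge_sum_inverse:
  "(\<Sum>d\<in>coprime6_upto z. 1 / real d) \<le> (\<Sum>E\<in>prime_sets_upto z. \<Prod>p\<in>E. 1 / (real p - 1))"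
proof -
  have "prime_factors ` coprime6_upto z \<subseteq> prime_sets_upto z"
  proof safe
    fix d assume d: "d \<in> coprime6_upto z"
    have pos: "d > 0" using coprime6_upto_pos[OF d] .
    have "5 \<le> p \<and> p \<le> z" if p: "p \<in> prime_factors d" for p
    proof -
      have "p dvd d" "prime p" using p by auto
      then have "p \<noteq> 2" "p \<noteq> 3" "p \<noteq> 4" using d by (auto simp: coprime6_upto_iff)
      moreover have "p \<ge> 2" using \<open>prime p\<close> prime_ge_2_nat by blast
      moreover have "p \<le> d" using \<open>p dvd d\<close> pos by (intro dvd_imp_le)
      ultimately show ?thesis using d by (simp add: coprime6_upto_def)
    qed
    moreover have "\<Prod>(prime_factors d) dvd (\<Prod>p\<in>prime_factors d. p ^ multiplicity p d)"
      by (intro prod_dvd_prod) (auto simp: prime_factors_multiplicity dvd_power)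
    then have "\<Prod>(prime_factors d) dvd d" using pos prime_factorization_nat[of d] by simp
    then have "\<Prod>(prime_factors d) \<le> d" using pos by (intro dvd_imp_le)
    ultimately show "prime_factors d \<in> prime_sets_upto z"
      using d by (auto simp: prime_sets_upto_def coprime6_upto_def)
  qed
  then have "(\<Sum>d\<in>coprime6_upto z. 1 / real d) =
      (\<Sum>E\<in>prime_sets_upto z. \<Sum>d | d \<in> coprime6_upto z \<and> prime_factors d = E. 1 / real d)"
    by (intro sum.group[symmetric] finite_prime_sets_upto) auto
  also have "\<dots> \<le> (\<Sum>E\<in>prime_sets_upto z. \<Prod>p\<in>E. 1 / (real p - 1))"
    by (intro sum_mono sum_inverse_same_prime_factors)
       (auto intro: coprime6_upto_pos prime_sets_uptoD)
  finally show ?thesis .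
qed

text \<open>Enlarging \<open>P\<close> to all odd numbers from 5 onwards gives a product that can be
  compared with a telescoping one.\<close>

lemma prod_one_plus_le:
  assumes "\<And>p. p \<in> P \<Longrightarrow> odd p \<and> 5 \<le> p \<and> p \<le> (z::nat)"
  shows "(\<Prod>p\<in>P. 1 + 2 / (real p * (real p - 1))) \<le> 4 / 3"
proof -
  let ?f = "\<lambda>p. 1 + 2 / (real p * (real p - 1))"
  \<comment> \<open>The extra factor dominates the remaining tail of the product. It equals 4/3 at
    \<open>K = 0\<close> and decreases to 1, which lets the induction close.\<close>
  have "(\<Prod>i<K. ?f (2 * i + 5)) * ((2 * real K + 4) / (2 * real K + 3)) \<le> 4 / 3" for K
  proof (induction K)
    case (Suc K)
    define x where "x = 2 * real K"
    have x: "x \<ge> 0" by (simp add: x_def)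
    have "(1 + 2 / ((x + 5) * (x + 4))) * ((x + 6) / (x + 5)) \<le> (x + 4) / (x + 3)"
    proof -
      have "(x + 5) * (x + 4) + 2 \<le> (x + 5)\<^sup>2 * (x + 4)\<^sup>2 / ((x + 6) * (x + 3))"
      proof -
        have "((x + 5) * (x + 4) + 2) * ((x + 6) * (x + 3)) = ((x + 5) * (x + 4))\<^sup>2 - 4"
          by (simp add: power2_eq_square algebra_simps)
        then have "((x + 5) * (x + 4) + 2) * ((x + 6) * (x + 3)) \<le> (x + 5)\<^sup>2 * (x + 4)\<^sup>2"
          by (simp add: power_mult_distrib)
        then show ?thesis using x by (simp add: pos_le_divide_eq)
      qed
      then have "((x + 5) * (x + 4) + 2) * ((x + 6) / ((x + 5)\<^sup>2 * (x + 4)))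
         \<le> ((x + 5)\<^sup>2 * (x + 4)\<^sup>2 / ((x + 6) * (x + 3))) * ((x + 6) / ((x + 5)\<^sup>2 * (x + 4)))"
        using x by (intro mult_right_mono) auto
      also have "\<dots> = (x + 4) / (x + 3)"
        using x by (simp add: power2_eq_square divide_simps)
      also have "((x + 5) * (x + 4) + 2) * ((x + 6) / ((x + 5)\<^sup>2 * (x + 4))) =
          (1 + 2 / ((x + 5) * (x + 4))) * ((x + 6) / (x + 5))"
        using x by (simp add: power2_eq_square divide_simps)
      finally show ?thesis .
    qed
    then have "(\<Prod>i<K. ?f (2 * i + 5)) * ((1 + 2 / ((x + 5) * (x + 4))) * ((x + 6) / (x + 5)))
      \<le> (\<Prod>i<K. ?f (2 * i + 5)) * ((x + 4) / (x + 3))"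
      by (intro mult_left_mono prod_nonneg) auto
    also have "\<dots> \<le> 4 / 3" using Suc by (simp add: x_def)
    finally show ?case by (simp add: x_def algebra_simps)
  qed simp
  moreover have "(\<Prod>i<K. ?f (2 * i + 5)) * 1 \<le> (\<Prod>i<K. ?f (2 * i + 5)) * ((2 * real K + 4) / (2 * real K + 3))" for K
    by (intro mult_left_mono prod_nonneg) auto
  ultimately have bound: "(\<Prod>i<K. ?f (2 * i + 5)) \<le> 4 / 3" for K by (smt (verit) mult.right_neutral)
  have "P \<subseteq> (\<lambda>i. 2 * i + 5) ` {..<z}"
  proof
    fix p assume "p \<in> P"
    then have "odd p" "5 \<le> p" "p \<le> z" using assms by auto
    then have "p = 2 * ((p - 5) div 2) + 5" "(p - 5) div 2 < z" by presburger+
    then show "p \<in> (\<lambda>i. 2 * i + 5) ` {..<z}" by blast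
  qed
  then have "prod ?f P \<le> prod ?f ((\<lambda>i. 2 * i + 5) ` {..<z})"
    by (intro prod_mono2) (auto intro!: add_nonneg_nonneg)
  also have "\<dots> = (\<Prod>i<z. ?f (2 * i + 5))"
    by (subst prod.reindex) (auto simp: inj_on_def)
  finally show ?thesis using bound[of z] by linarith
qed

text \<open>From 7 on, \<open>4 * p \<le> (p - 1)\<^sup>2\<close> bounds each factor by
  \<open>1 / sqrt p\<close>. Only \<open>p = 5\<close> fails, and it costs the factor sqrt(5)/2,
  which is below 9/8.\<close>

lemma prod_two_over_le:
  assumes "finite E" "\<And>p. p \<in> E \<Longrightarrow> 5 \<le> p \<and> p \<noteq> (6::nat)"
  shows "(\<Prod>p\<in>E. 2 / (real p - 1)) \<le> 9 / 8 / sqrt (real (\<Prod>E))"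
proof -
  have big: "2 / (real p - 1) \<le> 1 / sqrt (real p)" if "p \<ge> 7" for p :: nat
  proof -
    have "4 * real p \<le> (real p - 1)\<^sup>2"
    proof -
      have "7 * real p \<le> real p * real p" using that by (intro mult_right_mono) auto
      moreover have "(real p - 1)\<^sup>2 = real p * real p - 2 * real p + 1"
        by (simp add: power2_eq_square algebra_simps)
      ultimately show ?thesis by linarith
    qed
    then have "sqrt (4 * real p) \<le> sqrt ((real p - 1)\<^sup>2)" by (rule real_sqrt_le_mono)
    then have "2 * sqrt (real p) \<le> real p - 1" using that by (simp add: real_sqrt_mult)
    then show ?thesis using that by (simp add: field_simps)
  qed
  have small: "1 / 2 \<le> 9 / 8 / sqrt (5::real)"
  proof -
    have "sqrt (5::real) \<le> sqrt ((9 / 4)\<^sup>2)" by (rule real_sqrt_le_mono) (simp add: power2_eq_square)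
    then have "sqrt (5::real) \<le> 9 / 4" by simp
    then show ?thesis by (simp add: field_simps)
  qed
  have rest: "(\<Prod>p\<in>E - {5}. 2 / (real p - 1)) \<le> (\<Prod>p\<in>E - {5}. 1 / sqrt (real p))"
  proof (intro prod_mono conjI big)
    fix p assume "p \<in> E - {5}"
    then have "5 \<le> p" "p \<noteq> 6" "p \<noteq> 5" using assms(2) by auto
    then show "7 \<le> p" "0 \<le> 2 / (real p - 1)" by auto
  qed
  have nn: "(\<Prod>p\<in>E - {5}. 1 / sqrt (real p)) \<ge> 0" by (intro prod_nonneg) auto
  have eq: "(\<Prod>p\<in>F. 1 / sqrt (real p)) = 1 / sqrt (real (\<Prod>F))" if "finite F" for F
    using that by (induction F rule: finite_induct) (auto simp: real_sqrt_mult)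
  show ?thesis
  proof (cases "5 \<in> E")
    case False
    then have "E - {5} = E" by auto
    then have "(\<Prod>p\<in>E. 2 / (real p - 1)) \<le> 1 / sqrt (real (\<Prod>E))"
      using rest eq[OF assms(1)] by simp
    also have "\<dots> \<le> 9 / 8 / sqrt (real (\<Prod>E))"
      by (intro divide_right_mono real_sqrt_ge_zero of_nat_0_le_iff) simp
    finally show ?thesis .
  next
    case True
    have "(\<Prod>p\<in>E. 2 / (real p - 1)) = 1 / 2 * (\<Prod>p\<in>E - {5}. 2 / (real p - 1))"
      by (subst prod.remove[OF assms(1) True]) simp
    also have "\<dots> \<le> (9 / 8 / sqrt 5) * (\<Prod>p\<in>E - {5}. 1 / sqrt (real p))"
      using small rest nn by (intro mult_mono prod_nonneg) (auto dest: assms(2))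
    also have "\<dots> = 9 / 8 * (\<Prod>p\<in>E. 1 / sqrt (real p))"
      by (subst prod.remove[OF assms(1) True]) simp
    also have "\<dots> = 9 / 8 / sqrt (real (\<Prod>E))" using eq[OF assms(1)] by simp
    finally show ?thesis .
  qed
qed

text \<open>Removing \<open>F\<close> maps the supersets injectively to integers coprime to 6 of
  size at most \<open>z / \<Prod>F\<close>.\<close>

lemma card_prime_supersets_le:
  assumes F: "F \<in> prime_sets_upto z"
  shows "real (card {E \<in> prime_sets_upto z. F \<subseteq> E}) \<le> (real z / real (\<Prod>F) + 2) / 3"
proof -
  note DF = prime_sets_uptoD[OF F]
  define y where "y = z div \<Prod>F"
  have y1: "y \<ge> 1" unfolding y_def using DF(4,5) by (simp add: Suc_le_eq div_greater_zero_iff)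
  have "(\<lambda>E. \<Prod>(E - F)) ` {E \<in> prime_sets_upto z. F \<subseteq> E} \<subseteq> coprime6_upto y"
  proof safe
    fix E assume E: "E \<in> prime_sets_upto z" "F \<subseteq> E"
    note DE = prime_sets_uptoD[OF E(1)]
    have "\<Prod>(E - F) * \<Prod>F = \<Prod>E" using prod.subset_diff[OF E(2) DE(1), of "\<lambda>x. x"] by simp
    then have "\<Prod>(E - F) * \<Prod>F \<le> z" using DE(4) by simp
    then have "\<Prod>(E - F) \<le> y" unfolding y_def using DF(5) by (simp add: less_eq_div_iff_mult_less_eq)
    then show "\<Prod>(E - F) \<in> coprime6_upto y"
      using DE by (intro Prod_primes_in_coprime6_upto) auto
  qed
  moreover have "inj_on (\<lambda>E. \<Prod>(E - F)) {E \<in> prime_sets_upto z. F \<subseteq> E}"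
  proof (rule inj_onI)
    fix E G assume *: "E \<in> {E \<in> prime_sets_upto z. F \<subseteq> E}" "G \<in> {E \<in> prime_sets_upto z. F \<subseteq> E}"
      "\<Prod>(E - F) = \<Prod>(G - F)"
    have "E - F = G - F"
      by (rule inj_onD[OF inj_on_Prod_primes *(3)]) (use * prime_sets_uptoD in auto)
    then show "E = G" using * by blast
  qed
  ultimately have "card {E \<in> prime_sets_upto z. F \<subseteq> E} \<le> card (coprime6_upto y)"
    by (metis card_image card_mono finite_coprime6_upto)
  then have "real (card {E \<in> prime_sets_upto z. F \<subseteq> E}) \<le> (real y + 2) / 3"
    using card_coprime6_upto[OF y1] by linarith
  also have "real y \<le> real z / real (\<Prod>F)" unfolding y_def by (rule of_nat_div_le_of_nat)
  finally show ?thesis by simp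
qed

text \<open>Expand \<open>(p + 1) / (p - 1) = 1 + 2 / (p - 1)\<close> and count supersets. The
  leading part is at most z/3 times the product bound 4/3, that is 4z/9; the rest is at most
  sqrt(z)/2 + 1/4, which fits below 11z/20 from 38 on.\<close>

lemma sum_prime_sets_le:
  assumes z: "z \<ge> 38"
  shows "(\<Sum>E\<in>prime_sets_upto z. \<Prod>p\<in>E. (real p + 1) / (real p - 1)) \<le> 11 / 20 * real z"
proof -
  define D where "D = prime_sets_upto z"
  define k where "k F = (\<Prod>p\<in>F. 2 / (real p - 1))" for F :: "nat set"
  note DD = prime_sets_uptoD[of _ z, folded D_def]
  have finD: "finite D" unfolding D_def by (rule finite_prime_sets_upto)
  have knn: "k F \<ge> 0" if "F \<in> D" for F
    unfolding k_def using DD(3)[OF that] by (intro prod_nonneg) force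
  have "(\<Sum>E\<in>D. \<Prod>p\<in>E. (real p + 1) / (real p - 1)) = (\<Sum>E\<in>D. \<Sum>F | F \<in> D \<and> F \<subseteq> E. k F)"
  proof (intro sum.cong refl)
    fix E assume E: "E \<in> D"
    have "(\<Prod>p\<in>E. (real p + 1) / (real p - 1)) = (\<Prod>p\<in>E. 2 / (real p - 1) + 1)"
      using DD(3)[OF E] by (intro prod.cong refl) (force simp: field_simps)
    also have "\<dots> = (\<Sum>F\<in>Pow E. k F)"
      by (subst prod_add) (use DD(1)[OF E] in \<open>auto simp: k_def\<close>)
    also have "Pow E = {F. F \<in> D \<and> F \<subseteq> E}"
      using prime_sets_upto_downward E unfolding D_def by auto
    finally show "(\<Prod>p\<in>E. (real p + 1) / (real p - 1)) = (\<Sum>F | F \<in> D \<and> F \<subseteq> E. k F)" .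
  qed
  also have "\<dots> = (\<Sum>F\<in>D. \<Sum>E | E \<in> D \<and> F \<subseteq> E. k F)"
    by (rule sum.swap_restrict[OF finD finD])
  also have "\<dots> = (\<Sum>F\<in>D. k F * real (card {E \<in> D. F \<subseteq> E}))"
    by (simp add: mult.commute)
  also have "\<dots> \<le> (\<Sum>F\<in>D. k F * ((real z / real (\<Prod>F) + 2) / 3))"
    using card_prime_supersets_le[of _ z, folded D_def]
    by (intro sum_mono mult_left_mono knn)
  also have "\<dots> = real z / 3 * (\<Sum>F\<in>D. k F / real (\<Prod>F)) + 2 / 3 * (\<Sum>F\<in>D. k F)"
    unfolding sum_distrib_left sum.distrib[symmetric]
    by (intro sum.cong refl) (simp add: field_simps)
  finally have main: "(\<Sum>E\<in>D. \<Prod>p\<in>E. (real p + 1) / (real p - 1)) \<le>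
      real z / 3 * (\<Sum>F\<in>D. k F / real (\<Prod>F)) + 2 / 3 * (\<Sum>F\<in>D. k F)" .
  have A: "(\<Sum>F\<in>D. k F / real (\<Prod>F)) \<le> 4 / 3"
  proof -
    define P where "P = {p. prime p \<and> 5 \<le> p \<and> p \<le> z}"
    have finP: "finite P" unfolding P_def by (rule finite_subset[of _ "{..z}"]) auto
    have "(\<Sum>F\<in>D. k F / real (\<Prod>F)) = (\<Sum>F\<in>D. \<Prod>p\<in>F. 2 / (real p * (real p - 1)))"
      by (simp add: k_def of_nat_prod prod_dividef[symmetric] mult.commute)
    also have "\<dots> \<le> (\<Sum>F\<in>Pow P. \<Prod>p\<in>F. 2 / (real p * (real p - 1)))"
    proof (intro sum_mono2)
      show "D \<subseteq> Pow P" unfolding D_def P_def prime_sets_upto_def by auto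
      show "0 \<le> (\<Prod>p\<in>F. 2 / (real p * (real p - 1)))" if "F \<in> Pow P - D" for F
        using that unfolding P_def by (intro prod_nonneg) force
    qed (use finP in auto)
    also have "\<dots> = (\<Prod>p\<in>P. 2 / (real p * (real p - 1)) + 1)"
      by (subst prod_add) (use finP in auto)
    also have "\<dots> = (\<Prod>p\<in>P. 1 + 2 / (real p * (real p - 1)))" by (simp add: add.commute)
    also have "\<dots> \<le> 4 / 3"
    proof (rule prod_one_plus_le[of _ z])
      fix p assume "p \<in> P"
      then show "odd p \<and> 5 \<le> p \<and> p \<le> z" using prime_odd_nat[of p] by (simp add: P_def)
    qed
    finally show ?thesis .
  qed
  have B: "(\<Sum>F\<in>D. k F) \<le> 9 / 8 * (2 / 3 * sqrt (real z) + 1 / 3)"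
  proof -
    have "(\<Sum>F\<in>D. k F) \<le> (\<Sum>F\<in>D. 9 / 8 * (1 / sqrt (real (\<Prod>F))))"
    proof (intro sum_mono)
      fix F assume F: "F \<in> D"
      have "\<not> prime (6::nat)" using primes_dvd_imp_eq[of 2 "6::nat"] by auto
      then have "5 \<le> p \<and> p \<noteq> 6" if "p \<in> F" for p using DD(2,3)[OF F that] by auto
      then show "k F \<le> 9 / 8 * (1 / sqrt (real (\<Prod>F)))"
        using prod_two_over_le[OF DD(1)[OF F]] unfolding k_def by simp
    qed
    also have "\<dots> = 9 / 8 * (\<Sum>F\<in>D. 1 / sqrt (real (\<Prod>F)))" by (simp only: sum_distrib_left)
    also have "(\<Sum>F\<in>D. 1 / sqrt (real (\<Prod>F))) = (\<Sum>d\<in>(\<lambda>F. \<Prod>F) ` D. 1 / sqrt (real d))"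
    proof -
      have "inj_on (\<lambda>F. \<Prod>F) D" by (rule inj_on_subset[OF inj_on_Prod_primes]) (use DD in auto)
      then show ?thesis by (simp only: sum.reindex o_def)
    qed
    also have "\<dots> \<le> (\<Sum>d\<in>coprime6_upto z. 1 / sqrt (real d))"
      by (intro sum_mono2 image_subsetI Prod_primes_in_coprime6_upto) (auto dest: DD)
    also have "\<dots> \<le> 2 / 3 * sqrt (real z) + 1 / 3"
      using z by (intro sum_inverse_sqrt_coprime6_upto) auto
    finally show ?thesis by simp
  qed
  note main
  also have "real z / 3 * (\<Sum>F\<in>D. k F / real (\<Prod>F)) + 2 / 3 * (\<Sum>F\<in>D. k F) \<le>
      real z / 3 * (4 / 3) + 2 / 3 * (9 / 8 * (2 / 3 * sqrt (real z) + 1 / 3))"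
    by (intro add_mono mult_left_mono A B) auto
  also have "real z / 3 * (4 / 3) + 2 / 3 * (9 / 8 * (2 / 3 * sqrt (real z) + 1 / 3)) \<le> 11 / 20 * real z"
  proof -
    have "6 * sqrt (real z) \<le> sqrt (real z) * sqrt (real z)"
      by (intro mult_right_mono real_le_rsqrt) (use z in auto)
    then have "6 * sqrt (real z) \<le> real z" by simp
    moreover have "real z \<ge> 38" using z by simp
    moreover have "2 / 3 * (9 / 8 * (2 / 3 * sqrt (real z) + 1 / 3)) = sqrt (real z) / 2 + 1 / 4"
      by (simp add: field_simps)
    ultimately show ?thesis by linarith
  qed
  finally show ?thesis unfolding D_def .
qed

section \<open>Sifted intervals\<close>

lemma card_residues_mod6_le:
  fixes b c :: nat
  shows "card {r. r < 6 \<and> \<not> [r = b] (mod 2) \<and> \<not> [r = c] (mod 3)} \<le> 2"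
proof -
  have "{r. r < 6 \<and> \<not> [r = b] (mod 2) \<and> \<not> [r = c] (mod 3)} =
      {r \<in> {0, 1, 2, 3, 4, 5}. r mod 2 \<noteq> b mod 2 \<and> r mod 3 \<noteq> c mod 3}"
    by (auto simp: Cong.cong_def)
  also have "\<dots> = set (filter (\<lambda>r. r mod 2 \<noteq> b mod 2 \<and> r mod 3 \<noteq> c mod 3) [0, 1, 2, 3, 4, 5])"
    by auto
  also have "card \<dots> \<le> length (filter (\<lambda>r. r mod 2 \<noteq> b mod 2 \<and> r mod 3 \<noteq> c mod 3) [0, 1, 2, 3, 4, 5])"
    by (rule card_length)
  also have "\<dots> \<le> 2"
  proof -
    have "b mod 2 = 0 \<or> b mod 2 = 1" "c mod 3 = 0 \<or> c mod 3 = 1 \<or> c mod 3 = 2" by presburger+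
    then show ?thesis by auto
  qed
  finally show ?thesis .
qed

lemma solve_residue_mod6:
  fixes p a r :: nat
  assumes "prime p" "5 \<le> p"
  shows "\<exists>b. [6 * b + r = a] (mod p)"
proof -
  have "coprime 2 p" by (rule primes_coprime) (use assms in auto)
  moreover have "coprime 3 p" by (rule primes_coprime) (use assms in auto)
  ultimately have "coprime (2 * 3) p" by (simp only: coprime_mult_left_iff)
  then have "coprime 6 p" by simp
  then obtain x where x: "[6 * x = 1] (mod p)" using cong_solve_coprime_nat[of 6 p] by auto
  \<comment> \<open>With \<open>x\<close> inverse to 6, the solution is \<open>x * (a - r)\<close>;
    the natural number \<open>(p - 1) * r\<close> stands for \<open>- r\<close>.\<close>
  have "[(6 * x) * (a + (p - 1) * r) + r = 1 * (a + (p - 1) * r) + r] (mod p)"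
    using x by (intro cong_add cong_mult cong_refl)
  moreover have "1 * (a + (p - 1) * r) + r = a + p * r"
    using assms by (cases p) auto
  moreover have "[a + p * r = a] (mod p)" by (simp add: Cong.cong_def)
  ultimately have "[6 * (x * (a + (p - 1) * r)) + r = a] (mod p)"
    by (metis cong_trans mult.assoc)
  then show ?thesis ..
qed

text \<open>At most two classes modulo 6 survive 2 and 3. In each, \<open>t div 6\<close> runs
  through an interval of length about \<open>Y / 6\<close> and still avoids one class modulo every
  \<open>p\<close> in \<open>P\<close>, as 6 is invertible there. Twice Selberg's bound gives the
  main term \<open>Y / (3 * L)\<close>.\<close>

lemma selberg_sieve_mod6:
  fixes P :: "nat set" and a :: "nat \<Rightarrow> nat" and D :: "nat set set" and Y :: nat
  assumes fin: "finite P" and pr: "\<And>p. p \<in> P \<Longrightarrow> prime p \<and> 5 \<le> p"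
    and D: "D \<subseteq> Pow P" "{} \<in> D" "\<And>E F. F \<in> D \<Longrightarrow> E \<subseteq> F \<Longrightarrow> E \<in> D"
    and A: "A \<subseteq> {..<Y}"
    and avoid: "\<And>p t. p \<in> insert 2 (insert 3 P) \<Longrightarrow> t \<in> A \<Longrightarrow> \<not> [t = a p] (mod p)"
  defines "L \<equiv> \<Sum>E\<in>D. \<Prod>p\<in>E. 1 / (real p - 1)"
    and "R \<equiv> \<Sum>E\<in>D. \<Prod>p\<in>E. (real p + 1) / (real p - 1)"
  shows "real (card A) \<le> (real Y + 5) / (3 * L) + 2 * (R / L)\<^sup>2"
proof -
  define Q where "Q = {r. r < 6 \<and> \<not> [r = a 2] (mod 2) \<and> \<not> [r = a 3] (mod 3)}"
  \<comment> \<open>The ceiling of \<open>Y / 6\<close>, so that \<open>t < Y\<close> implies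
    \<open>t div 6 < X\<close>.\<close>
  define X where "X = (Y + 5) div 6"
  have finA: "finite A" using A finite_subset by blast
  have finQ: "finite Q" unfolding Q_def by simp
  have Lnn: "L \<ge> 0" unfolding L_def
  proof (intro sum_nonneg prod_nonneg)
    fix E p assume "E \<in> D" "p \<in> E"
    then have "5 \<le> p" using D(1) pr by blast
    then show "0 \<le> 1 / (real p - 1)" by simp
  qed
  have "(\<lambda>t. t mod 6) ` A \<subseteq> Q"
  proof safe
    fix t assume t: "t \<in> A"
    have "t mod 6 mod 2 = t mod 2" "t mod 6 mod 3 = t mod 3" by (simp_all add: mod_mod_cancel)
    then show "t mod 6 \<in> Q" using avoid[of 2 t] avoid[of 3 t] t by (simp add: Q_def Cong.cong_def)
  qed
  then have "card A = (\<Sum>r\<in>Q. card {t \<in> A. t mod 6 = r})"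
    using sum.group[OF finA finQ, of "\<lambda>t. t mod 6" "\<lambda>_. 1 :: nat"] by simp
  then have "real (card A) = (\<Sum>r\<in>Q. real (card {t \<in> A. t mod 6 = r}))" by simp
  also have "\<dots> \<le> (\<Sum>r\<in>Q. real X / L + (R / L)\<^sup>2)"
  proof (intro sum_mono)
    fix r assume "r \<in> Q"
    have "\<exists>b. \<forall>p\<in>P. [6 * b p + r = a p] (mod p)"
      using solve_residue_mod6 pr by (intro bchoice) blast
    then obtain b where b: "\<And>p. p \<in> P \<Longrightarrow> [6 * b p + r = a p] (mod p)" by blast
    have "(\<lambda>t. t div 6) ` {t \<in> A. t mod 6 = r} \<subseteq> {t. t < X \<and> (\<forall>p\<in>P. \<not> [t = b p] (mod p))}"
    proof safe
      fix t assume t: "t \<in> A" "r = t mod 6"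
      have "t < Y" using t A by auto
      then show "t div 6 < X" unfolding X_def by linarith
      fix p assume p: "p \<in> P" "[t div 6 = b p] (mod p)"
      then have "[6 * (t div 6) + r = 6 * b p + r] (mod p)" by (intro cong_add cong_mult cong_refl)
      then have "[t = a p] (mod p)" using b[OF p(1)] t by (metis cong_trans mult_div_mod_eq)
      then show False using avoid[of p t] p t by blast
    qed
    moreover have "inj_on (\<lambda>t. t div 6) {t \<in> A. t mod 6 = r}"
      by (rule inj_onI) (metis (mono_tags) div_mod_decomp mem_Collect_eq)
    ultimately have "card {t \<in> A. t mod 6 = r} \<le> card {t. t < X \<and> (\<forall>p\<in>P. \<not> [t = b p] (mod p))}"
      by (intro card_inj_on_le[of "\<lambda>t. t div 6"]) auto
    also have "real \<dots> \<le> real X / L + (R / L)\<^sup>2"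
      unfolding L_def R_def using fin pr D by (intro selberg_sieve) auto
    finally show "real (card {t \<in> A. t mod 6 = r}) \<le> real X / L + (R / L)\<^sup>2" by simp
  qed
  also have "\<dots> = real (card Q) * (real X / L + (R / L)\<^sup>2)" by simp
  also have "\<dots> \<le> 2 * (real X / L + (R / L)\<^sup>2)"
    using card_residues_mod6_le[of "a 2" "a 3"] Lnn unfolding Q_def[symmetric]
    by (intro mult_right_mono add_nonneg_nonneg divide_nonneg_nonneg) auto
  also have "\<dots> = 6 * real X / (3 * L) + 2 * (R / L)\<^sup>2" by simp
  also have "\<dots> \<le> (real Y + 5) / (3 * L) + 2 * (R / L)\<^sup>2"
  proof -
    have "6 * X \<le> Y + 5" unfolding X_def by simp
    then have "6 * real X \<le> real Y + 5" by linarith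
    then show ?thesis using Lnn by (intro add_right_mono divide_right_mono) auto
  qed
  finally show ?thesis .
qed

text \<open>The smallest useful family of moduli, 1 and the primes themselves, keeps
  \<open>L\<close> and \<open>R\<close> explicit for numerical use.\<close>

lemma selberg_sieve_singletons:
  fixes P :: "nat set" and a :: "nat \<Rightarrow> nat" and Y :: nat
  assumes fin: "finite P" and pr: "\<And>p. p \<in> P \<Longrightarrow> prime p \<and> 5 \<le> p"
    and A: "A \<subseteq> {..<Y}"
    and avoid: "\<And>p t. p \<in> insert 2 (insert 3 P) \<Longrightarrow> t \<in> A \<Longrightarrow> \<not> [t = a p] (mod p)"
  defines "L \<equiv> 1 + (\<Sum>p\<in>P. 1 / (real p - 1))"
    and "R \<equiv> 1 + (\<Sum>p\<in>P. (real p + 1) / (real p - 1))"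
  shows "real (card A) \<le> (real Y + 5) / (3 * L) + 2 * (R / L)\<^sup>2"
proof -
  define D where "D = insert {} ((\<lambda>p. {p}) ` P)"
  have sum: "(\<Sum>E\<in>D. prod f E) = 1 + sum f P" for f :: "nat \<Rightarrow> real"
    unfolding D_def using fin by (subst sum.insert) (auto simp: sum.reindex)
  have "real (card A) \<le> (real Y + 5) / (3 * (\<Sum>E\<in>D. \<Prod>p\<in>E. 1 / (real p - 1))) +
      2 * ((\<Sum>E\<in>D. \<Prod>p\<in>E. (real p + 1) / (real p - 1)) / (\<Sum>E\<in>D. \<Prod>p\<in>E. 1 / (real p - 1)))\<^sup>2"
    by (rule selberg_sieve_mod6[OF fin pr _ _ _ A avoid]) (auto simp: D_def subset_singleton_iff)
  then show ?thesis unfolding sum L_def R_def .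
qed

text \<open>The tangent at \<open>exp t\<close> lies above the concave logarithm, and replacing e by
  the smaller 2.7182 only raises the line.\<close>

lemma ln_le_tangent:
  fixes y :: real
  assumes "y > 0"
  shows "ln y \<le> real t - 1 + y / (27182 / 10000) ^ t"
proof -
  have "ln (y / exp (real t)) \<le> y / exp (real t) - 1" using assms by (intro ln_le_minus_one) simp
  then have "ln y \<le> real t - 1 + y / exp (real t)" using assms by (simp add: ln_divide_pos)
  moreover have "(27182 / 10000) ^ t \<le> exp (real t)"
    using power_mono[OF exp_1_ge, of t] by (simp flip: exp_of_nat_mult)
  then have "y / exp (real t) \<le> y / (27182 / 10000) ^ t"
    using assms by (intro divide_left_mono) auto
  ultimately show ?thesis by linarith
qed

text \<open>With the tangent bound for the logarithm, the claim becomes a convex quadratic inequality,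
  so that it suffices to verify it at the two ends of the interval.\<close>

lemma linear_less_via_tangent:
  fixes u v y y1 y2 :: real and t :: nat
  defines "w \<equiv> 1 / (27182 / 10000) ^ t"
  assumes "0 \<le> u" "0 < y1" "y1 \<le> y" "y \<le> y2"
    and "(u * y1 + v) * (real t - 1 + y1 * w) < 2 * y1"
    and "(u * y2 + v) * (real t - 1 + y2 * w) < 2 * y2"
    and "0 \<le> u * y + v" "1 < y" "T \<le> u * y + v"
  shows "T < 2 * y / ln y"
proof -
  have w: "w > 0" by (simp add: w_def)
  define q where "q x = (u * x + v) * (real t - 1 + x * w) - 2 * x" for x
  have "q y < 0"
  proof (cases "y1 = y2")
    case True
    then show ?thesis using assms by (simp add: q_def)
  next
    case False
    then have lt: "y1 < y2" using assms by linarith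
    \<comment> \<open>The exact deviation of a quadratic with leading coefficient
      \<open>u * w\<close> from its chord.\<close>
    have "(y2 - y1) * q y = (y2 - y) * q y1 + (y - y1) * q y2 - u * w * ((y2 - y1) * ((y - y1) * (y2 - y)))"
      unfolding q_def by (simp add: algebra_simps)
    moreover have "u * w * ((y2 - y1) * ((y - y1) * (y2 - y))) \<ge> 0"
      using assms w lt by simp
    moreover have "(y2 - y) * q y1 + (y - y1) * q y2 < 0"
    proof (cases "y = y1")
      case True
      then show ?thesis using lt assms by (simp add: q_def mult_pos_neg)
    next
      case False
      then have "(y - y1) * q y2 < 0" using assms by (simp add: q_def mult_pos_neg)
      moreover have "(y2 - y) * q y1 \<le> 0" using assms by (simp add: q_def mult_nonneg_nonpos)
      ultimately show ?thesis by linarith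
    qed
    ultimately have "(y2 - y1) * q y < 0" by linarith
    then show ?thesis using lt by (simp add: mult_less_0_iff)
  qed
  moreover have "ln y \<le> real t - 1 + y * w" using ln_le_tangent[of y t] assms by (simp add: w_def)
  then have "(u * y + v) * ln y \<le> (u * y + v) * (real t - 1 + y * w)"
    using assms by (intro mult_left_mono)
  moreover have "ln y > 0" using assms by simp
  then have "T * ln y \<le> (u * y + v) * ln y" using assms by (intro mult_right_mono) auto
  ultimately have "T * ln y < 2 * y" unfolding q_def by linarith
  then show ?thesis using \<open>ln y > 0\<close> by (simp add: pos_less_divide_eq)
qed

theorem sifted_interval_less:
  fixes Y :: nat and a :: "nat \<Rightarrow> nat"
  assumes Y: "Y \<ge> 3" and A: "A \<subseteq> {..<Y}"
    and avoid: "\<And>p t. prime p \<Longrightarrow> p \<le> Y \<Longrightarrow> t \<in> A \<Longrightarrow> \<not> [t = a p] (mod p)"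
  shows "real (card A) < 2 * real Y / ln (real Y)"
proof -
  have rY: "real Y \<ge> 3" using Y by simp
  consider "Y \<le> 300" | "300 \<le> Y" "Y \<le> 13000" | "13000 \<le> Y" by linarith
  then show ?thesis
  proof cases
    case 1
    \<comment> \<open>Sieving by 2 and 3 alone, so \<open>L = R = 1\<close>. The subranges below are
      matched to tangent points \<open>exp t\<close> inside or near them.\<close>
    have "real (card A) \<le> (real Y + 5) / (3 * (1 + (\<Sum>p\<in>{}. 1 / (real p - 1)))) +
       2 * ((1 + (\<Sum>p\<in>{}. (real p + 1) / (real p - 1))) / (1 + (\<Sum>p\<in>{}. 1 / (real p - 1))))\<^sup>2"
      by (rule selberg_sieve_singletons[OF _ _ A, where a = a]) (use Y avoid in auto)
    then have T: "real (card A) \<le> 1 / 3 * real Y + 11 / 3" by (simp add: add_divide_distrib)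
    consider "Y \<le> 5" | "5 \<le> Y" "Y \<le> 20" | "20 \<le> Y" "Y \<le> 130" | "130 \<le> Y" by linarith
    then show ?thesis
    proof cases
      case 1
      then show ?thesis
        by (intro linear_less_via_tangent[of "1/3" 3 "real Y" 5 "11/3" 1]) (use rY T in simp_all)
    next
      case 2
      then show ?thesis
        by (intro linear_less_via_tangent[of "1/3" 5 "real Y" 20 "11/3" 2])
           (use rY T in \<open>simp_all add: power_divide\<close>)
    next
      case 3
      then show ?thesis
        by (intro linear_less_via_tangent[of "1/3" 20 "real Y" 130 "11/3" 4])
           (use rY T in \<open>simp_all add: power_divide\<close>)
    next
      case 4
      then show ?thesis
        by (intro linear_less_via_tangent[of "1/3" 130 "real Y" 300 "11/3" 6])
           (use rY T \<open>Y \<le> 300\<close> in \<open>simp_all add: power_divide\<close>)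
    qed
  next
    case 2
    let ?P = "{5, 7, 11, 13, 17} :: nat set"
    have "prime (5::nat)" "prime (7::nat)" "prime (11::nat)" "prime (13::nat)" "prime (17::nat)" by simp_all
    then have P: "prime p \<and> 5 \<le> p" if "p \<in> ?P" for p using that by auto
    have "real (card A) \<le> (real Y + 5) / (3 * (1 + (\<Sum>p\<in>?P. 1 / (real p - 1)))) +
       2 * ((1 + (\<Sum>p\<in>?P. (real p + 1) / (real p - 1))) / (1 + (\<Sum>p\<in>?P. 1 / (real p - 1))))\<^sup>2"
    proof (rule selberg_sieve_singletons[OF _ P A, where a = a])
      fix p t assume p: "p \<in> insert 2 (insert 3 ?P)" "t \<in> A"
      then have "prime p" "p \<le> 17" by auto
      moreover have "p \<le> Y" using \<open>p \<le> 17\<close> 2 by linarith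
      ultimately show "\<not> [t = a p] (mod p)" using avoid p by blast
    qed auto
    \<comment> \<open>Here \<open>L = 133 / 80\<close>, whence the slope; 40 rounds up the remaining
      constant.\<close>
    then have T: "real (card A) \<le> 80 / 399 * real Y + 40" by (simp add: power_divide add_divide_distrib)
    consider "Y \<le> 1400" | "1400 \<le> Y" by linarith
    then show ?thesis
    proof cases
      case 1
      then show ?thesis
        by (intro linear_less_via_tangent[of "80/399" 300 "real Y" 1400 40 6])
           (use rY T 2 in \<open>simp_all add: power_divide\<close>)
    next
      case 2
      then show ?thesis
        by (intro linear_less_via_tangent[of "80/399" 1400 "real Y" 13000 40 9])
           (use rY T \<open>Y \<le> 13000\<close> in \<open>simp_all add: power_divide\<close>)
    qed
  next
    case 3
    define z where "z = nat \<lfloor>sqrt (real Y) / 3\<rfloor>"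
    define L where "L = (\<Sum>E\<in>prime_sets_upto z. \<Prod>p\<in>E. 1 / (real p - 1))"
    define R where "R = (\<Sum>E\<in>prime_sets_upto z. \<Prod>p\<in>E. (real p + 1) / (real p - 1))"
    \<comment> \<open>In this notation the target is \<open>Y / l\<close>, and \<open>l\<close> is
      the logarithm of sqrt(Y).\<close>
    define l where "l = ln (real Y) / 2"
    define P where "P = {p. prime p \<and> 5 \<le> p \<and> p \<le> z}"
    \<comment> \<open>As 114 = 3 * 38 and 114^2 < 13000, this puts the level \<open>z\<close> in the
      range where the bounds for \<open>L\<close> and \<open>R\<close> hold.\<close>
    have s: "sqrt (real Y) \<ge> 114" by (rule real_le_rsqrt) (use 3 in simp)
    have zs: "real z \<le> sqrt (real Y) / 3" "sqrt (real Y) / 3 < real z + 1"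
      unfolding z_def using s by linarith+
    have z38: "z \<ge> 38" unfolding z_def using s by (simp add: le_nat_iff le_floor_iff)
    have "sqrt (real Y) * 1 \<le> sqrt (real Y) * sqrt (real Y)" using s by (intro mult_left_mono) linarith+
    then have "sqrt (real Y) \<le> real Y" by simp
    then have "real z \<le> real Y" using zs(1) s by linarith
    then have zY: "z \<le> Y" by simp
    have fin: "finite P" unfolding P_def by (rule finite_subset[of _ "{..z}"]) auto
    have main: "real (card A) \<le> (real Y + 5) / (3 * L) + 2 * (R / L)\<^sup>2"
      unfolding L_def R_def
    proof (rule selberg_sieve_mod6[OF fin _ _ _ _ A, where a = a])
      show "prime_sets_upto z \<subseteq> Pow P" unfolding prime_sets_upto_def P_def by auto
      show "{} \<in> prime_sets_upto z" unfolding prime_sets_upto_def using z38 by simp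
      show "E \<in> prime_sets_upto z" if "F \<in> prime_sets_upto z" "E \<subseteq> F" for E F
        using prime_sets_upto_downward that by blast
      show "prime p \<and> 5 \<le> p" if "p \<in> P" for p using that by (simp add: P_def)
      fix p t assume p: "p \<in> insert 2 (insert 3 P)" "t \<in> A"
      then have "prime p" "p \<le> Y" using 3 zY by (auto simp: P_def)
      then show "\<not> [t = a p] (mod p)" using avoid p by blast
    qed
    have l: "l > 0" unfolding l_def using rY by simp
    have "l = ln (sqrt (real Y))" unfolding l_def using rY by (simp add: ln_sqrt)
    also have "\<dots> \<le> ln (3 * (real z + 1))"
    proof -
      have "0 < sqrt (real Y)" "sqrt (real Y) \<le> 3 * (real z + 1)" using s zs(2) by (linarith, simp)
      then show ?thesis by (meson ln_le_cancel_iff less_le_trans)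
    qed
    finally have L: "l + 13 / 20 \<le> 3 * L"
      using sum_inverse_coprime6_upto[of z] sum_prime_sets_ge_sum_inverse[of z] z38
      unfolding L_def by linarith
    have R0: "R \<ge> 0" unfolding R_def
      by (intro sum_nonneg prod_nonneg) (auto dest!: prime_sets_uptoD(3))
    have "R \<le> 11 / 20 * (sqrt (real Y) / 3)" using sum_prime_sets_le[OF z38] zs(1) unfolding R_def by linarith
    then have "R\<^sup>2 \<le> (11 / 20 * (sqrt (real Y) / 3))\<^sup>2" using R0 by (intro power_mono)
    then have R: "18 * R\<^sup>2 \<le> 121 / 200 * real Y" by (simp add: power_mult_distrib power_divide)
    define q where "q = l + 13 / 20"
    have q: "q > 0" "q \<le> 3 * L" using l L by (auto simp: q_def)
    have "(real Y + 5) / (3 * L) \<le> (real Y + 5) / q" using q by (intro divide_left_mono) auto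
    moreover have "2 * (R / L)\<^sup>2 = 18 * R\<^sup>2 / (3 * L)\<^sup>2" by (simp add: power_divide power_mult_distrib)
    moreover have "\<dots> \<le> (121 / 200 * real Y) / q\<^sup>2"
      using R q by (intro frac_le power_mono) auto
    ultimately have "real (card A) \<le> (real Y + 5) / q + (121 / 200 * real Y) / q\<^sup>2" using main by linarith
    also have "\<dots> = ((real Y + 5) * q + 121 / 200 * real Y) / q\<^sup>2"
      using q by (simp add: field_simps power2_eq_square)
    \<comment> \<open>After clearing denominators, the secondary term 13/20 beats the error 121/200
      by 9/200, and this margin absorbs \<open>5 * q\<close> for large \<open>Y\<close>.\<close>
    also have "\<dots> < real Y / l"
    proof -
      have "ln (real Y) \<le> 8 + real Y / 1000"
      proof -
        have "real Y / (27182 / 10000) ^ 9 \<le> real Y / 1000" by (intro divide_left_mono) (auto simp: power_divide)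
        moreover have "ln (real Y) \<le> 8 + real Y / (27182 / 10000) ^ 9"
          using ln_le_tangent[of "real Y" 9] rY by simp
        ultimately show ?thesis by linarith
      qed
      moreover have "real Y \<ge> 13000" using 3 by simp
      moreover have "5 * q = 5 / 2 * ln (real Y) + 13 / 4" by (simp add: q_def l_def)
      ultimately have "5 * q < 9 / 200 * real Y" by linarith
      then have "l * (5 * q) < l * (9 / 200 * real Y)" using l by (intro mult_strict_left_mono)
      moreover have "q\<^sup>2 * real Y = l * (real Y * q) + 13 / 20 * (l * real Y) + (13 / 20)\<^sup>2 * real Y"
        unfolding q_def by (simp add: power2_eq_square algebra_simps)
      moreover have "l * ((real Y + 5) * q + 121 / 200 * real Y) =
          l * (real Y * q) + l * (5 * q) + 121 / 200 * (l * real Y)" by (simp add: algebra_simps)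
      moreover have "l * (9 / 200 * real Y) = 9 / 200 * (l * real Y)" by simp
      moreover have "(13 / 20)\<^sup>2 * real Y > 0" using rY by simp
      ultimately have "l * ((real Y + 5) * q + 121 / 200 * real Y) < q\<^sup>2 * real Y" by linarith
      then show ?thesis using l q by (simp add: divide_simps mult.commute)
    qed
    also have "\<dots> = 2 * real Y / ln (real Y)" by (simp add: l_def)
    finally show ?thesis .
  qed
qed

section \<open>Chains of prime truncations\<close>

lemma exists_sparse_residue_class:
  fixes B :: "nat set" and p :: nat
  assumes "finite B" "p > 0"
  shows "\<exists>r. real (card {t \<in> B. [t = r] (mod p)}) \<le> real (card B) / real p"
proof (rule ccontr)
  assume "\<nexists>r. real (card {t \<in> B. [t = r] (mod p)}) \<le> real (card B) / real p"
  then have *: "real (card B) / real p < real (card {t \<in> B. [t = r] (mod p)})" for r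
    by (meson not_le)
  have "real (card B) = (\<Sum>r<p. real (card B) / real p)" using assms by simp
  also have "\<dots> < (\<Sum>r<p. real (card {t \<in> B. [t = r] (mod p)}))"
    using assms * by (intro sum_strict_mono) auto
  also have "\<dots> = (\<Sum>r<p. real (card {t \<in> B. t mod p = r}))"
    by (intro sum.cong refl) (simp add: Cong.cong_def)
  also have "\<dots> = real (card B)"
  proof -
    have "(\<lambda>t. t mod p) ` B \<subseteq> {..<p}" using assms(2) by auto
    then show ?thesis
      using sum.group[OF assms(1), of "{..<p}" "\<lambda>t. t mod p" "\<lambda>_. 1 :: real"] by simp
  qed
  finally show False by simp
qed

text \<open>By averaging, some class modulo \<open>p\<close> holds at most a share
  \<open>1 / p\<close> of what is left. Dropping such a class for one prime after another multiplies
  the surviving proportions.\<close>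

lemma exists_sparse_residue_classes:
  fixes A T :: "nat set"
  assumes "finite A" "finite T" "\<And>p. p \<in> T \<Longrightarrow> p > 0"
  shows "\<exists>a. real (card A) * (\<Prod>p\<in>T. 1 - 1 / real p) \<le> real (card {t \<in> A. \<forall>p\<in>T. \<not> [t = a p] (mod p)})"
  using assms(2,3)
proof (induction T rule: finite_induct)
  case (insert p T)
  then obtain a where
    a: "real (card A) * (\<Prod>p\<in>T. 1 - 1 / real p) \<le> real (card {t \<in> A. \<forall>p\<in>T. \<not> [t = a p] (mod p)})"
    by auto
  define B where "B = {t \<in> A. \<forall>p\<in>T. \<not> [t = a p] (mod p)}"
  have p: "p > 0" using insert by auto
  have finB: "finite B" using assms(1) by (simp add: B_def)
  obtain r where r: "real (card {t \<in> B. [t = r] (mod p)}) \<le> real (card B) / real p"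
    using exists_sparse_residue_class[OF finB p] by blast
  have "{t \<in> A. \<forall>q\<in>insert p T. \<not> [t = (a(p := r)) q] (mod q)} = B - {t \<in> B. [t = r] (mod p)}"
    using insert.hyps(2) by (auto simp: B_def)
  then have "real (card {t \<in> A. \<forall>q\<in>insert p T. \<not> [t = (a(p := r)) q] (mod q)}) =
      real (card B) - real (card {t \<in> B. [t = r] (mod p)})"
    using finB by (simp add: card_Diff_subset of_nat_diff card_mono)
  also have "\<dots> \<ge> real (card B) * (1 - 1 / real p)" using r by (simp add: algebra_simps)
  also have "real (card B) * (1 - 1 / real p) \<ge>
      (real (card A) * (\<Prod>p\<in>T. 1 - 1 / real p)) * (1 - 1 / real p)"
    using a p unfolding B_def by (intro mult_right_mono) auto
  also have "(real (card A) * (\<Prod>p\<in>T. 1 - 1 / real p)) * (1 - 1 / real p) =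
      real (card A) * (\<Prod>p\<in>insert p T. 1 - 1 / real p)"
    using insert.hyps by (simp add: mult_ac)
  finally show ?case by blast
qed simp

text \<open>The bound is uniform in \<open>u\<close> and \<open>N\<close>. The condition
  \<open>u > Y\<close> prevents a sieving prime \<open>p \<le> Y\<close> from being itself one of
  the primes counted.\<close>

lemma brun_titchmarsh_power_modulus:
  fixes g Y u N :: nat
  assumes g: "g > 0" and Y: "Y \<ge> 3" and u: "u > Y"
  shows "real (card {j. j < Y \<and> prime (u + j * g ^ N)}) * (real (totient g) / real g) < 2 * real Y / ln (real Y)"
proof -
  define A where "A = {j. j < Y \<and> prime (u + j * g ^ N)}"
  have finA: "finite A" by (simp add: A_def)
  obtain a where a: "real (card A) * (\<Prod>p\<in>prime_factors g. 1 - 1 / real p)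
      \<le> real (card {t \<in> A. \<forall>p\<in>prime_factors g. \<not> [t = a p] (mod p)})"
    using exists_sparse_residue_classes[OF finA, of "prime_factors g"]
    by (auto simp: prime_gt_0_nat in_prime_factors_imp_prime)
  define B where "B = {t \<in> A. \<forall>p\<in>prime_factors g. \<not> [t = a p] (mod p)}"
  have "\<exists>c. \<forall>t\<in>B. \<not> [t = c] (mod p)" if p: "prime p" "p \<le> Y" for p
  proof (cases "p dvd g")
    case True
    then have "p \<in> prime_factors g" using p g by (simp add: prime_factors_dvd)
    then show ?thesis by (auto simp: B_def)
  next
    case False
    then have "coprime g p" using p(1) by (metis coprime_commute prime_imp_coprime)
    then have "coprime (g ^ N) p" by simp
    then obtain x where x: "[g ^ N * x = 1] (mod p)" using cong_solve_coprime_nat[of "g ^ N" p] by auto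
    \<comment> \<open>The avoided class is the root of \<open>u + t * g ^ N\<close> modulo
      \<open>p\<close>; \<open>(p - 1) * u\<close> stands for \<open>- u\<close>.\<close>
    have "\<not> [t = x * ((p - 1) * u)] (mod p)" if t: "t \<in> B" for t
    proof
      assume "[t = x * ((p - 1) * u)] (mod p)"
      then have "[u + t * g ^ N = u + x * ((p - 1) * u) * g ^ N] (mod p)"
        by (intro cong_add cong_mult cong_refl)
      also have "u + x * ((p - 1) * u) * g ^ N = u + (g ^ N * x) * ((p - 1) * u)" by (simp add: mult_ac)
      also have "[\<dots> = u + 1 * ((p - 1) * u)] (mod p)"
        using x by (intro cong_add cong_mult cong_refl)
      also have "u + 1 * ((p - 1) * u) = p * u" using prime_gt_0_nat[OF p(1)] by (cases p) auto
      finally have "p dvd u + t * g ^ N" by (simp add: Cong.cong_def mod_eq_0_iff_dvd)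
      moreover have "prime (u + t * g ^ N)" using t by (simp add: A_def B_def)
      ultimately have "p = u + t * g ^ N" using p(1) primes_dvd_imp_eq by blast
      then show False using p(2) u by linarith
    qed
    then show ?thesis by blast
  qed
  then have "\<forall>p\<in>{p. prime p \<and> p \<le> Y}. \<exists>c. \<forall>t\<in>B. \<not> [t = c] (mod p)" by blast
  from bchoice[OF this] obtain c where "\<forall>p\<in>{p. prime p \<and> p \<le> Y}. \<forall>t\<in>B. \<not> [t = c p] (mod p)" ..
  then have "real (card B) < 2 * real Y / ln (real Y)"
    by (intro sifted_interval_less[OF Y, of B c]) (auto simp: A_def B_def)
  moreover have "real (totient g) / real g = (\<Prod>p\<in>prime_factors g. 1 - 1 / real p)"
    using g by (simp add: totient_formula2)
  ultimately show ?thesis using a unfolding A_def[symmetric] B_def by simp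
qed

text \<open>A digit string is stored as the number it represents, and truncation becomes reduction
  modulo \<open>g ^ n\<close>. The leading digit may be 0, so this set can exceed the one behind
  \<open>P_count\<close>.\<close>

definition prime_chain_ends :: "nat \<Rightarrow> nat \<Rightarrow> nat set" where
  "prime_chain_ends g N = {u. u < g ^ N \<and> (\<forall>n\<in>{1..N}. prime (u mod g ^ n))}"

lemma finite_prime_chain_ends: "finite (prime_chain_ends g N)"
  by (rule finite_subset[of _ "{..<g ^ N}"]) (auto simp: prime_chain_ends_def)

section \<open>From digit sequences to chain ends\<close>

lemma trunc_Suc: "trunc d g (Suc n) = trunc d g n + d n * g ^ n"
  by (simp add: trunc_def)

lemma trunc_less:
  assumes "\<And>i. d i < g"
  shows "trunc d g n < g ^ n"
proof (induction n)
  case (Suc n)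
  have "Suc (d n) * g ^ n \<le> g * g ^ n" using assms[of n] by (intro mult_right_mono) auto
  then show ?case using Suc by (simp add: trunc_Suc)
qed (simp add: trunc_def)

lemma trunc_mod:
  assumes "\<And>i. d i < g" "n \<le> N"
  shows "trunc d g N mod g ^ n = trunc d g n"
  using assms(2)
proof (induction N rule: dec_induct)
  case base
  then show ?case using trunc_less[of d g n] assms(1) by simp
next
  case (step N)
  have "d N * g ^ N mod g ^ n = 0" using step.hyps by (simp add: le_imp_power_dvd mod_eq_0_iff_dvd)
  then have "trunc d g (Suc N) mod g ^ n = trunc d g N mod g ^ n"
    unfolding trunc_Suc by (metis add.right_neutral mod_add_right_eq)
  then show ?case using step.IH by simp
qed

lemma P_count_le_card_prime_chain_ends:
  assumes "g \<ge> 3"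
  shows "P_count g N \<le> card (prime_chain_ends g N)"
proof -
  let ?S = "{d \<in> digit_seqs g N. prime_trunc_count d g N = N - eta g}"
  have "inj_on (\<lambda>d. trunc d g N) ?S"
  proof (rule inj_onI)
    fix d e assume "d \<in> ?S" "e \<in> ?S" and eq: "trunc d g N = trunc e g N"
    then have d: "\<And>i. d i < g" "\<And>i. i \<ge> N \<Longrightarrow> d i = 0" and e: "\<And>i. e i < g" "\<And>i. i \<ge> N \<Longrightarrow> e i = 0"
      by (auto simp: digit_seqs_def)
    have "d i = e i" for i
    proof (cases "i < N")
      case True
      have "trunc d g n = trunc e g n" if "n \<le> N" for n
        using trunc_mod[of d g n N] trunc_mod[of e g n N] d e that eq by simp
      then have "trunc d g (Suc i) = trunc e g (Suc i)" "trunc d g i = trunc e g i" using True by auto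
      then show ?thesis using assms by (simp add: trunc_Suc)
    qed (use d e in auto)
    then show "d = e" by blast
  qed
  moreover have "(\<lambda>d. trunc d g N) ` ?S \<subseteq> prime_chain_ends g N"
  proof safe
    fix d assume d: "d \<in> digit_seqs g N" "prime_trunc_count d g N = N - eta g"
    have dg: "\<And>i. d i < g" using d by (auto simp: digit_seqs_def)
    \<comment> \<open>Since \<open>eta g = 0\<close>, the count is full and every truncation must be
      prime.\<close>
    have "card {n \<in> {1..N}. prime (trunc d g n)} = card {1..N}"
      using d assms by (simp add: prime_trunc_count_def eta_def)
    then have "{n \<in> {1..N}. prime (trunc d g n)} = {1..N}" by (intro card_subset_eq) auto
    then have "prime (trunc d g n)" if "n \<in> {1..N}" for n using that by blast
    then show "trunc d g N \<in> prime_chain_ends g N"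
      using trunc_less[of d g N] trunc_mod[of d g _ N] dg by (auto simp: prime_chain_ends_def)
  qed
  ultimately show ?thesis
    unfolding P_count_def by (intro card_inj_on_le finite_prime_chain_ends)
qed

text \<open>Split a longer chain end into its lowest \<open>N\<close> digits and the block
  \<open>j\<close> of \<open>m\<close> new ones; of the new truncations, only primality of the whole
  number is used. At most \<open>Y + 1\<close> values \<open>u \<le> Y\<close> escape the
  hypothesis, each with at most \<open>Y\<close> extensions.\<close>

lemma card_prime_chain_ends_step:
  fixes g m N \<sigma> :: nat
  defines "Y \<equiv> g ^ m"
  assumes g: "g > 0" and m: "m \<ge> 1"
    and \<sigma>: "\<And>u. u > Y \<Longrightarrow> card {j. j < Y \<and> prime (u + j * g ^ N)} \<le> \<sigma>"
  shows "card (prime_chain_ends g (N + m)) \<le> \<sigma> * card (prime_chain_ends g N) + (Y + 1) * Y"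
proof -
  let ?W = "prime_chain_ends g"
  let ?J = "\<lambda>u. {j. j < Y \<and> prime (u + j * g ^ N)}"
  have "(\<lambda>v. (v mod g ^ N, v div g ^ N)) ` ?W (N + m) \<subseteq> Sigma (?W N) ?J"
  proof safe
    fix v assume v: "v \<in> ?W (N + m)"
    then have "v < g ^ N * Y" by (simp add: prime_chain_ends_def Y_def power_add)
    then show "v div g ^ N < Y" by (simp add: less_mult_imp_div_less mult.commute)
    have "(v mod g ^ N) mod g ^ n = v mod g ^ n" if "n \<le> N" for n
      using that by (simp add: mod_mod_cancel le_imp_power_dvd)
    then show "v mod g ^ N \<in> ?W N" using v g by (auto simp: prime_chain_ends_def)
    have "N + m \<in> {1..N + m}" using m by simp
    then have "prime (v mod g ^ (N + m))" using v unfolding prime_chain_ends_def by blast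
    then show "prime (v mod g ^ N + v div g ^ N * g ^ N)"
      using v unfolding mod_div_mult_eq by (simp add: prime_chain_ends_def)
  qed
  moreover have "inj_on (\<lambda>v. (v mod g ^ N, v div g ^ N)) (?W (N + m))"
    by (rule inj_onI) (metis div_mod_decomp prod.inject)
  ultimately have "card (?W (N + m)) \<le> card (Sigma (?W N) ?J)"
    using finite_prime_chain_ends by (intro card_inj_on_le[of "\<lambda>v. (v mod g ^ N, v div g ^ N)"]) auto
  also have "\<dots> = (\<Sum>u\<in>?W N. card (?J u))" using finite_prime_chain_ends by simp
  also have "\<dots> \<le> (\<Sum>u\<in>?W N. \<sigma> + (if u \<le> Y then Y else 0))"
  proof (intro sum_mono)
    fix u assume "u \<in> ?W N"
    have "card (?J u) \<le> card {..<Y}" by (intro card_mono) auto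
    then show "card (?J u) \<le> \<sigma> + (if u \<le> Y then Y else 0)" using \<sigma>[of u] by auto
  qed
  also have "\<dots> = \<sigma> * card (?W N) + Y * card {u \<in> ?W N. u \<le> Y}"
    using finite_prime_chain_ends[of g N] by (simp add: sum.distrib sum.If_cases Int_def)
  also have "\<dots> \<le> \<sigma> * card (?W N) + Y * card {..Y}"
    by (intro add_left_mono mult_left_mono card_mono) auto
  finally show ?thesis by (simp add: algebra_simps)
qed

text \<open>Raising the rate from \<open>\<sigma>\<close> to \<open>\<tau>\<close> leaves room
  \<open>(\<tau> - \<sigma>) * \<tau> ^ k\<close> at each step, and the constant is chosen so that
  this covers \<open>K\<close>.\<close>

lemma linear_recurrence_bound:
  fixes x :: "nat \<Rightarrow> real"
  assumes "x 0 \<le> M" "\<And>k. x (Suc k) \<le> \<sigma> * x k + K"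
    and "0 \<le> \<sigma>" "\<sigma> < \<tau>" "1 \<le> \<tau>" "0 \<le> K" "0 \<le> M"
  shows "x k \<le> (M + K / (\<tau> - \<sigma>)) * \<tau> ^ k"
proof (induction k)
  case 0
  have "K / (\<tau> - \<sigma>) \<ge> 0" using assms by simp
  then show ?case using assms(1) by simp
next
  case (Suc k)
  define C where "C = M + K / (\<tau> - \<sigma>)"
  have "K = K / (\<tau> - \<sigma>) * (\<tau> - \<sigma>)" using assms by simp
  also have "\<dots> \<le> C * (\<tau> - \<sigma>)" using assms unfolding C_def by (intro mult_right_mono) auto
  also have "\<dots> * 1 \<le> C * (\<tau> - \<sigma>) * \<tau> ^ k"
    using assms unfolding C_def by (intro mult_left_mono mult_nonneg_nonneg one_le_power) auto
  finally have K: "K \<le> C * (\<tau> - \<sigma>) * \<tau> ^ k" by simp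
  have "\<sigma> * x k \<le> \<sigma> * (C * \<tau> ^ k)" using Suc assms unfolding C_def by (intro mult_left_mono)
  then show ?case using assms(2)[of k] K unfolding C_def[symmetric] by (simp add: algebra_simps)
qed

section \<open>The growth rate of the number of chains\<close>

theorem theorem3p1:
  "\<exists>C::real. C > 0 \<and>
     (\<forall>g::nat. g \<ge> 3 \<longrightarrow>
        (\<exists>N0::nat. \<forall>N\<ge>N0. real (P_count g N) \<le> C * gamma_const g ^ N))"
proof (rule exI[of _ 1], intro conjI allI impI)
  fix g :: nat assume g: "g \<ge> 3"
  obtain m where m: "m \<ge> 1" and gam: "gamma_const g = real g * gamma_term g m"
    using gamma_min_attained[OF g] by blast
  define Y where "Y = g ^ m"
  define G where "G = gamma_const g ^ m"
  let ?W = "\<lambda>N. card (prime_chain_ends g N)"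
  have tot: "0 < totient g" "totient g \<le> g" using g by (auto simp: totient_le)
  have Y3: "Y \<ge> 3" unfolding Y_def using g m self_le_power[of g m] by linarith
  have lnY: "ln (real Y) = real m * ln (real g)" unfolding Y_def using g by (simp add: ln_realpow)
  have lnY0: "ln (real Y) > 0" using Y3 by simp
  \<comment> \<open>The m-th power removes the root in \<open>gamma_term\<close>, leaving exactly
    the sieve bound for one block of \<open>m\<close> digits.\<close>
  have G: "G = 2 * real Y / ln (real Y) * (real g / real (totient g))"
  proof -
    define b where "b = 2 * real g / (real m * real (totient g) * ln (real g))"
    have "b > 0" unfolding b_def using g m tot by simp
    then have "gamma_term g m ^ m = b"
      using m unfolding gamma_term_def b_def[symmetric] by (simp add: powr_power)
    then have "G = real Y * b" unfolding G_def gam Y_def by (simp add: power_mult_distrib)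
    then show ?thesis unfolding b_def lnY by (simp add: mult_ac)
  qed
  have G1: "G > 1"
  proof -
    have "ln (real Y) \<le> real Y - 1" using Y3 by (intro ln_le_minus_one) simp
    then have "1 < 2 * real Y / ln (real Y)" using lnY0 Y3 by (simp add: pos_less_divide_eq)
    moreover have "1 \<le> real g / real (totient g)" using tot by simp
    ultimately have "1 * 1 < 2 * real Y / ln (real Y) * (real g / real (totient g))"
      by (intro mult_less_le_imp_less) auto
    then show ?thesis unfolding G by simp
  qed
  have gam0: "gamma_const g \<ge> 0" unfolding gam gamma_term_def by simp
  have gam1: "gamma_const g \<ge> 1"
    using G1 power_le_one[of "gamma_const g" m] gam0 unfolding G_def by linarith
  \<comment> \<open>The largest integer strictly below \<open>G\<close>. The number of extensions is
    an integer below \<open>G\<close>, hence at most \<open>\<sigma>\<close>.\<close>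
  define \<sigma> where "\<sigma> = nat (\<lceil>G\<rceil> - 1)"
  have \<sigma>G: "real \<sigma> < G" unfolding \<sigma>_def using G1 by linarith
  have step: "?W (N + m) \<le> \<sigma> * ?W N + (Y + 1) * Y" for N
    unfolding Y_def
  proof (rule card_prime_chain_ends_step)
    fix u assume "u > g ^ m"
    then have "real (card {j. j < Y \<and> prime (u + j * g ^ N)}) * (real (totient g) / real g)
        < 2 * real Y / ln (real Y)"
      using g Y3 unfolding Y_def by (intro brun_titchmarsh_power_modulus) auto
    then have "real (card {j. j < Y \<and> prime (u + j * g ^ N)}) * (real (totient g) / real g)
        * (real g / real (totient g)) < G"
      unfolding G using tot g by (intro mult_strict_right_mono) auto
    then have "real (card {j. j < Y \<and> prime (u + j * g ^ N)}) < G" using tot g by simp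
    then have "card {j. j < Y \<and> prime (u + j * g ^ N)} \<le> \<sigma>" unfolding \<sigma>_def by linarith
    then show "card {j. j < g ^ m \<and> prime (u + j * g ^ N)} \<le> \<sigma>" unfolding Y_def .
  qed (use g m in auto)
  \<comment> \<open>A rate strictly between \<open>\<sigma>\<close> and \<open>G\<close>; the
    maximum with 1 secures \<open>1 \<le> \<tau>\<close>, as the recurrence bound requires.\<close>
  define \<tau> where "\<tau> = (max (real \<sigma>) 1 + G) / 2"
  have \<tau>: "real \<sigma> < \<tau>" "1 \<le> \<tau>" "\<tau> < G" unfolding \<tau>_def using \<sigma>G G1 by (auto simp: max_def)
  define C where "C = real Y + real ((Y + 1) * Y) / (\<tau> - real \<sigma>)"
  \<comment> \<open>Cut \<open>N\<close> into \<open>N div m\<close> blocks above the lowest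
    \<open>N mod m\<close> digits, which admit at most \<open>Y\<close> chain ends.\<close>
  have bound: "real (?W N) \<le> C * \<tau> ^ (N div m)" for N
  proof -
    have "?W (N mod m) \<le> card {..<g ^ (N mod m)}"
      by (intro card_mono) (auto simp: prime_chain_ends_def)
    also have "\<dots> \<le> Y" unfolding Y_def using g m by (simp add: power_increasing)
    finally have "real (?W (N mod m + m * 0)) \<le> real Y" by simp
    moreover have "real (?W (N mod m + m * Suc k)) \<le> real \<sigma> * real (?W (N mod m + m * k)) + real ((Y + 1) * Y)" for k
      using step[of "N mod m + m * k"] by (simp add: add_ac flip: of_nat_mult of_nat_add)
    ultimately have "real (?W (N mod m + m * (N div m))) \<le> C * \<tau> ^ (N div m)"
      unfolding C_def using \<tau> by (intro linear_recurrence_bound) auto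
    then show ?thesis by simp
  qed
  \<comment> \<open>The gap between \<open>\<tau>\<close> and \<open>G\<close> swallows
    \<open>C\<close>, which depends on \<open>g\<close>; this is why the final constant can be
    1.\<close>
  obtain k0 where k0: "C < (G / \<tau>) ^ k0" using real_arch_pow[of "G / \<tau>" C] \<tau> by auto
  show "\<exists>N0. \<forall>N\<ge>N0. real (P_count g N) \<le> 1 * gamma_const g ^ N"
  proof (intro exI[of _ "m * k0"] allI impI)
    fix N assume "N \<ge> m * k0"
    then have k: "N div m \<ge> k0" using m by (simp add: less_eq_div_iff_mult_less_eq mult.commute)
    have "real (P_count g N) \<le> real (?W N)" using P_count_le_card_prime_chain_ends[OF g] by simp
    also have "\<dots> \<le> C * \<tau> ^ (N div m)" by (rule bound)
    also have "\<dots> \<le> (G / \<tau>) ^ (N div m) * \<tau> ^ (N div m)"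
    proof -
      have "(G / \<tau>) ^ k0 \<le> (G / \<tau>) ^ (N div m)" using k \<tau> by (intro power_increasing) auto
      then have "C \<le> (G / \<tau>) ^ (N div m)" using k0 by linarith
      then show ?thesis using \<tau> by (intro mult_right_mono) auto
    qed
    also have "\<dots> = G ^ (N div m)" using \<tau> by (simp add: power_divide)
    also have "\<dots> = gamma_const g ^ (m * (N div m))" unfolding G_def by (simp add: power_mult)
    \<comment> \<open>The exponent may be rounded up to \<open>N\<close> because
      \<open>gamma_const g \<ge> 1\<close>.\<close>
    also have "\<dots> \<le> gamma_const g ^ N" using gam1 by (intro power_increasing) auto
    finally show "real (P_count g N) \<le> 1 * gamma_const g ^ N" by simp
  qed
qed simp

end
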